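(* Let $p=0.2$, $\mathcal{S}=\{0,1,2\}$, $p_S(0)=p_S(1)=p/2$, $p_S(2)=1-p$, and let $\mathcal{X}_1=\mathcal{X}_2=\mathcal{Y}=\{0,1\}$. For $\alpha\in(0,1)$ let the channel $p_{Y|X_2,S}$ be as follows: for $s=0$ it is the Z-channel with $Y=0$ if $x_2=0$, and $Y=0$ with probability $\alpha$, $Y=1$ with probability $1-\alpha$ if $x_2=1$; for $s=1$ it is the S-channel with $Y=1$ if $x_2=1$, and $Y=1$ with probability $\alpha$, $Y=0$ with probability $1-\alpha$ if $x_2=0$; for $s=2$ it is noiseless, $Y=x_2$. Let $C_{\mathrm{nc}}$ be the capacity of the state-encoder channel with non-causal state information at the state encoder and strictly causal observation of its output by the transmitter, and let $C_{\mathrm{c}}$ be the capacity of the state-encoder channel with causal state information at the state encoder and causal observation of its output by the transmitter (in both cases the decoder knows $S^n$). Then for every $\alpha\in(0,1)$, $$C_{\mathrm{nc}}>C_{\mathrm{c}}.$$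
   Context: In both settings the states $S_1,\dots,S_n$ are i.i.d. $\sim p_S$, the message $M_2$ is uniform on $[1:2^{nR_2}]$ (with $2^{nR_2}$ treated as an integer) and independent of $S^n$, the channel is memoryless and without feedback ($Y_i$ is drawn from $p_{Y|X_2,S}(\cdot|x_{2,i},s_i)$), and the decoder is a map $\hat m_2:\mathcal{Y}^n\times\mathcal{S}^n\to[1:2^{nR_2}]$. Non-causal setting (capacity $C_{\mathrm{nc}}$): state encoder $x_{1,i}:\mathcal{S}^n\to\mathcal{X}_1$, transmitter $x_{2,i}:[1:2^{nR_2}]\times\mathcal{X}_1^{i-1}\to\mathcal{X}_2$, $1\le i\le n$. Causal setting (capacity $C_{\mathrm{c}}$): state encoder $x_{1,i}:\mathcal{S}^i\to\mathcal{X}_1$, transmitter $x_{2,i}:[1:2^{nR_2}]\times\mathcal{X}_1^{i}\to\mathcal{X}_2$, $1\le i\le n$. A rate is achievable if for every $\epsilon>0$ there is, for some sufficiently large $n$, a code with $\Pr[\hat m_2(Y^n,S^n)\ne M_2]\le\epsilon$; the capacity is the supremum of achievable rates. The single-letter capacity expressions for the two settings are $$C_{\mathrm{nc}}=\max_{p_{U|S}p_{X_2|U}:\ I(U;S)\le\log_2|\mathcal{X}_1|} I(X_2;Y|S,U),\qquad C_{\mathrm{c}}=\max_{\mathbf{1}_{X_1|S}\,p_{X_2|X_1}} I(X_2;Y|S,X_1),$$ where in the second expression $X_1$ is a deterministic function of $S$. *)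

theory Defs
  imports "HOL-Probability.Probability" "HOL-Library.Numeral_Type"
begin

section \<open>State-encoder channels\<close>

text \<open>
  Alphabets are types. A sequence is a list of length \<open>n\<close>, and its time-\<open>i\<close> entry (with
  \<open>1 \<le> i \<le> n\<close>) is the list element at position \<open>i - 1\<close>; thus \<open>take i xs\<close> is the
  prefix \<open>x\<^sup>i\<close>.
\<close>

type_synonym ('s, 'x1) state_encoder = "nat \<Rightarrow> 's list \<Rightarrow> 'x1"
type_synonym ('x1, 'x2) transmitter = "nat \<Rightarrow> nat \<Rightarrow> 'x1 list \<Rightarrow> 'x2"
type_synonym ('y, 's) decoder = "'y list \<Rightarrow> 's list \<Rightarrow> nat"

text \<open>Non-causal setting: \<open>x\<^sub>1\<^sub>,\<^sub>i(s\<^sup>n)\<close> and \<open>x\<^sub>2\<^sub>,\<^sub>i(m, x\<^sub>1\<^sup>i\<^sup>-\<^sup>1)\<close>.\<close>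

definition inputs_nc ::
  "nat \<Rightarrow> ('s, 'x1) state_encoder \<Rightarrow> ('x1, 'x2) transmitter \<Rightarrow> nat \<Rightarrow> 's list \<Rightarrow> 'x2 list" where
  "inputs_nc n f g m s =
     (let x1 = map (\<lambda>i. f i s) [1..<Suc n]
      in map (\<lambda>i. g i m (take (i - 1) x1)) [1..<Suc n])"

text \<open>Causal setting: \<open>x\<^sub>1\<^sub>,\<^sub>i(s\<^sup>i)\<close> and \<open>x\<^sub>2\<^sub>,\<^sub>i(m, x\<^sub>1\<^sup>i)\<close>.\<close>

definition inputs_c ::
  "nat \<Rightarrow> ('s, 'x1) state_encoder \<Rightarrow> ('x1, 'x2) transmitter \<Rightarrow> nat \<Rightarrow> 's list \<Rightarrow> 'x2 list" where
  "inputs_c n f g m s =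
     (let x1 = map (\<lambda>i. f i (take i s)) [1..<Suc n]
      in map (\<lambda>i. g i m (take i x1)) [1..<Suc n])"

text \<open>The channel law \<open>p\<^sub>Y\<^sub>|\<^sub>X\<^sub>2\<^sub>,\<^sub>S\<close> is given as \<open>W x\<^sub>2 s\<close>.\<close>

fun memoryless :: "('x \<Rightarrow> 's \<Rightarrow> 'y pmf) \<Rightarrow> 'x list \<Rightarrow> 's list \<Rightarrow> 'y list pmf" where
  "memoryless W (x # xs) (s # ss) =
     bind_pmf (W x s) (\<lambda>y. map_pmf ((#) y) (memoryless W xs ss))"
| "memoryless W _ _ = return_pmf []"

text \<open>Joint law of \<open>(M\<^sub>2, S\<^sup>n, Y\<^sup>n)\<close>, where \<open>\<phi> m s\<close> is the channel input sequence.\<close>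

definition transmission ::
  "'s pmf \<Rightarrow> ('x \<Rightarrow> 's \<Rightarrow> 'y pmf) \<Rightarrow> nat \<Rightarrow> nat \<Rightarrow> (nat \<Rightarrow> 's list \<Rightarrow> 'x list)
     \<Rightarrow> (nat \<times> 's list \<times> 'y list) pmf" where
  "transmission pS W n M \<phi> =
     bind_pmf (pmf_of_set {1..M}) (\<lambda>m.
     bind_pmf (replicate_pmf n pS) (\<lambda>s.
     map_pmf (\<lambda>y. (m, s, y)) (memoryless W (\<phi> m s) s)))"

definition error_prob ::
  "'s pmf \<Rightarrow> ('x \<Rightarrow> 's \<Rightarrow> 'y pmf) \<Rightarrow> nat \<Rightarrow> nat \<Rightarrow> (nat \<Rightarrow> 's list \<Rightarrow> 'x list)
     \<Rightarrow> ('y, 's) decoder \<Rightarrow> real" where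
  "error_prob pS W n M \<phi> dec =
     measure_pmf.prob (transmission pS W n M \<phi>) {(m, s, y). dec y s \<noteq> m}"

definition valid_decoder :: "nat \<Rightarrow> nat \<Rightarrow> ('y, 's) decoder \<Rightarrow> bool" where
  "valid_decoder n M dec \<longleftrightarrow>
     (\<forall>y s. length y = n \<longrightarrow> length s = n \<longrightarrow> dec y s \<in> {1..M})"

text \<open>\<open>2\<^sup>n\<^sup>R\<close> rounded up to an integer.\<close>

definition num_messages :: "nat \<Rightarrow> real \<Rightarrow> nat" where
  "num_messages n R = nat \<lceil>2 powr (real n * R)\<rceil>"

text \<open>
  Since the alphabet of the state encoder does not occur in the channel, it is passed as a type
  argument. Codes must exist for arbitrarily large \<open>n\<close>; without this, \<open>n = 0\<close> would make every
  rate achievable.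
\<close>

definition achievable_nc ::
  "'x1 itself \<Rightarrow> 's pmf \<Rightarrow> ('x2 \<Rightarrow> 's \<Rightarrow> 'y pmf) \<Rightarrow> real \<Rightarrow> bool" where
  "achievable_nc _ pS W R \<longleftrightarrow> 0 \<le> R \<and>
     (\<forall>\<epsilon>>0. \<forall>N. \<exists>n\<ge>N. \<exists>(f :: ('s, 'x1) state_encoder) (g :: ('x1, 'x2) transmitter) dec.
        valid_decoder n (num_messages n R) dec \<and>
        error_prob pS W n (num_messages n R) (inputs_nc n f g) dec \<le> \<epsilon>)"

definition achievable_c ::
  "'x1 itself \<Rightarrow> 's pmf \<Rightarrow> ('x2 \<Rightarrow> 's \<Rightarrow> 'y pmf) \<Rightarrow> real \<Rightarrow> bool" where
  "achievable_c _ pS W R \<longleftrightarrow> 0 \<le> R \<and>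
     (\<forall>\<epsilon>>0. \<forall>N. \<exists>n\<ge>N. \<exists>(f :: ('s, 'x1) state_encoder) (g :: ('x1, 'x2) transmitter) dec.
        valid_decoder n (num_messages n R) dec \<and>
        error_prob pS W n (num_messages n R) (inputs_c n f g) dec \<le> \<epsilon>)"

text \<open>Suprema are taken in the extended reals, where they need no boundedness side condition.\<close>

definition capacity_nc ::
  "'x1 itself \<Rightarrow> 's pmf \<Rightarrow> ('x2 \<Rightarrow> 's \<Rightarrow> 'y pmf) \<Rightarrow> ereal" where
  "capacity_nc X1 pS W = (SUP R \<in> {R. achievable_nc X1 pS W R}. ereal R)"

definition capacity_c ::
  "'x1 itself \<Rightarrow> 's pmf \<Rightarrow> ('x2 \<Rightarrow> 's \<Rightarrow> 'y pmf) \<Rightarrow> ereal" where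
  "capacity_c X1 pS W = (SUP R \<in> {R. achievable_c X1 pS W R}. ereal R)"


section \<open>The Z/S/noiseless example\<close>

text \<open>
  The numeral types \<open>2\<close> and \<open>3\<close> are the sets \<open>{0, 1}\<close> and \<open>{0, 1, 2}\<close>.
\<close>

definition state_pmf :: "real \<Rightarrow> 3 pmf" where
  "state_pmf p = pmf_of_list [(0, p / 2), (1, p / 2), (2, 1 - p)]"

definition bit_pmf :: "real \<Rightarrow> 2 pmf" where
  "bit_pmf q = map_pmf (\<lambda>b. if b then 1 else 0) (bernoulli_pmf q)"

definition zs_channel :: "real \<Rightarrow> 2 \<Rightarrow> 3 \<Rightarrow> 2 pmf" where
  "zs_channel \<alpha> x s =
     (if s = 0 then (if x = 0 then return_pmf 0 else bit_pmf (1 - \<alpha>))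
      else if s = 1 then (if x = 1 then return_pmf 1 else bit_pmf \<alpha>)
      else return_pmf x)"

lemma distinct_3: "(0::3) \<noteq> 1" "(0::3) \<noteq> 2" "(1::3) \<noteq> 2"
  by simp_all

lemma pmf_state_pmf:
  assumes "0 \<le> p" "p \<le> 1"
  shows "pmf (state_pmf p) 0 = p / 2" "pmf (state_pmf p) 1 = p / 2" "pmf (state_pmf p) 2 = 1 - p"
proof -
  have wf: "pmf_of_list_wf [(0::3, p / 2), (1, p / 2), (2, 1 - p)]"
    using assms by (auto simp: pmf_of_list_wf_def)
  show "pmf (state_pmf p) 0 = p / 2" "pmf (state_pmf p) 1 = p / 2" "pmf (state_pmf p) 2 = 1 - p"
    using distinct_3 unfolding state_pmf_def pmf_pmf_of_list[OF wf] by simp_all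
qed

lemma pmf_bit_pmf:
  assumes "0 \<le> q" "q \<le> 1"
  shows "pmf (bit_pmf q) 0 = 1 - q" "pmf (bit_pmf q) 1 = q"
proof -
  have inj: "inj (\<lambda>b. if b then 1 else 0 :: 2)"
    by (auto simp: inj_def)
  show "pmf (bit_pmf q) 0 = 1 - q" "pmf (bit_pmf q) 1 = q"
    unfolding bit_pmf_def
    using pmf_map_inj'[OF inj, of "bernoulli_pmf q" False]
          pmf_map_inj'[OF inj, of "bernoulli_pmf q" True] assms by simp_all
qed

end

theory Submission
  imports Defs
begin

text \<open>
  The state entropy is below one bit, so with non-causal state information the state encoder can
  describe the states of each block, one bit per channel use, during the block before it. Hence the
  transmitter can use the optimal input distribution of each of the three channels, and (in nats)
  \<open>C\<^sub>n\<^sub>c \<ge> 0.8 ln 2 + 0.2 C\<^sub>Z\<close>, where \<open>C\<^sub>Z\<close> is the capacity of the Z-channel. In the causal setting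
  the current state reaches the transmitter only through one bit \<open>h(s)\<close>, where \<open>h\<close> depends on the
  past states alone. By the dual form of capacity, output laws \<open>Q\<^sub>h(\<cdot>|s)\<close> for which
  \<open>\<Sum>\<^sub>s p(s) D(W(\<cdot>|x(h(s)),s) \<parallel> Q\<^sub>h(\<cdot>|s)) \<le> C\<close> holds for all maps \<open>h\<close> and \<open>x\<close> bound the causal
  capacity by \<open>C\<close>. The optimal output laws of the three channels give equality with
  \<open>0.8 ln 2 + 0.2 C\<^sub>Z\<close> for every \<open>x\<close>. Each \<open>h\<close> merges two states, and these have no common optimal
  input distribution because the Z-channel uses the input \<open>1\<close> with probability below \<open>1/2\<close>; a small
  change of their output laws therefore makes all the inequalities strict.
\<close>

section \<open>Sums over sequences\<close>

definition seqs :: "nat \<Rightarrow> 'a list set" where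
  "seqs n = {xs. length xs = n}"

lemma length_seqs: "xs \<in> seqs n \<Longrightarrow> length xs = n"
  by (simp add: seqs_def)

lemma seqs_0: "seqs 0 = {[]}"
  by (auto simp: seqs_def)

lemma seqs_add: "seqs (m + n) = (\<lambda>(xs, ys). xs @ ys) ` (seqs m \<times> seqs n)"
proof (intro set_eqI iffI)
  fix zs :: "'a list"
  assume "zs \<in> seqs (m + n)"
  then have "zs = (\<lambda>(xs, ys). xs @ ys) (take m zs, drop m zs)"
    "(take m zs, drop m zs) \<in> seqs m \<times> seqs n"
    by (auto simp: seqs_def)
  then show "zs \<in> (\<lambda>(xs, ys). xs @ ys) ` (seqs m \<times> seqs n)"
    by blast
qed (auto simp: seqs_def)

lemma finite_seqs [simp]: "finite (seqs n :: 'a::finite list set)"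
  using finite_lists_length_eq[of "UNIV :: 'a set" n] by (simp add: seqs_def)

lemma card_seqs: "card (seqs n :: 'a::finite list set) = CARD('a) ^ n"
  using card_lists_length_eq[of "UNIV :: 'a set" n] by (simp add: seqs_def)

lemma sum_seqs_add:
  "(\<Sum>xs\<in>seqs (m + n). F xs) = (\<Sum>xs\<in>seqs m. \<Sum>ys\<in>seqs n. F (xs @ ys))"
  unfolding seqs_add
  by (subst sum.reindex) (auto simp: inj_on_def seqs_def sum.cartesian_product case_prod_unfold)

lemma sum_seqs_Suc:
  fixes F :: "'a::finite list \<Rightarrow> 'b::comm_monoid_add"
  shows "(\<Sum>xs\<in>seqs (Suc n). F xs) = (\<Sum>x\<in>UNIV. \<Sum>xs\<in>seqs n. F (x # xs))"
proof -
  have 1: "seqs (Suc 0) = (\<lambda>x::'a. [x]) ` UNIV"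
    by (auto simp: seqs_def length_Suc_conv)
  show ?thesis
    using sum_seqs_add[of F "Suc 0" n] unfolding 1
    by (simp add: sum.reindex inj_on_def)
qed

text \<open>Turns a pair of blocks into one sequence of pair letters, the form to which the weak law
  of large numbers applies.\<close>

lemma sum_seqs_zip:
  fixes F :: "('a::finite \<times> 'b::finite) list \<Rightarrow> 'c::comm_monoid_add"
  shows "(\<Sum>xs\<in>seqs n. \<Sum>ys\<in>seqs n. F (zip xs ys)) = (\<Sum>zs\<in>seqs n. F zs)"
proof (induction n arbitrary: F)
  case 0
  then show ?case by (simp add: seqs_0)
next
  case (Suc n)
  have "(\<Sum>xs\<in>seqs (Suc n). \<Sum>ys\<in>seqs (Suc n). F (zip xs ys)) =
    (\<Sum>x\<in>UNIV. \<Sum>y\<in>UNIV. \<Sum>xs\<in>seqs n. \<Sum>ys\<in>seqs n. F ((x, y) # zip xs ys))"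
    by (simp add: sum_seqs_Suc) (intro sum.cong refl sum.swap)
  also have "\<dots> = (\<Sum>x\<in>UNIV. \<Sum>y\<in>UNIV. \<Sum>zs\<in>seqs n. F ((x, y) # zs))"
    by (intro sum.cong refl) (rule Suc.IH)
  also have "\<dots> = (\<Sum>z\<in>UNIV. \<Sum>zs\<in>seqs n. F (z # zs))"
    using sum.cartesian_product[of "\<lambda>x y. \<Sum>zs\<in>seqs n. F ((x, y) # zs)" UNIV UNIV] by simp
  finally show ?case
    by (simp add: sum_seqs_Suc)
qed

lemma sum_seqs_prod_list:
  fixes J :: "'a::finite \<Rightarrow> 'b::comm_semiring_1"
  shows "(\<Sum>xs\<in>seqs n. prod_list (map J xs)) = (\<Sum>x\<in>UNIV. J x) ^ n"
  by (induction n) (simp_all add: seqs_0 sum_seqs_Suc sum_distrib_left[symmetric] sum_distrib_right[symmetric])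

lemma prod_list_map_nonneg:
  fixes J :: "'a \<Rightarrow> 'b::linordered_semidom"
  assumes "\<And>x. 0 \<le> J x"
  shows "0 \<le> prod_list (map J xs)"
  by (induction xs) (simp_all add: assms)

text \<open>Chebyshev's inequality for the product law with letter weights \<open>J\<close>. The
  one-sided form suffices: it is applied to the negative information density and to the
  self-information.\<close>

lemma chebyshev_seqs:
  fixes J f :: "'a::finite \<Rightarrow> real"
  assumes J: "\<And>x. 0 \<le> J x" "(\<Sum>x\<in>UNIV. J x) = 1"
    and d: "(\<Sum>x\<in>UNIV. J x * f x) < c" and \<epsilon>: "0 < \<epsilon>"
  shows "\<forall>\<^sub>F n in sequentially.
    (\<Sum>xs\<in>seqs n. prod_list (map J xs) * of_bool (real n * c \<le> sum_list (map f xs))) \<le> \<epsilon>"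
proof -
  define \<mu> where "\<mu> = (\<Sum>x\<in>UNIV. J x * f x)"
  define g where "g = (\<lambda>x. f x - \<mu>)"
  define V where "V = (\<Sum>x\<in>UNIV. J x * (g x)\<^sup>2)"
  define P where "P = (\<lambda>xs. prod_list (map J xs))"
  define G where "G = (\<lambda>xs. sum_list (map g xs))"
  have P0: "0 \<le> P xs" for xs
    unfolding P_def using J(1) by (rule prod_list_map_nonneg)
  have P1: "(\<Sum>xs\<in>seqs n. P xs) = 1" for n
    by (simp add: P_def sum_seqs_prod_list J)
  have Jg: "(\<Sum>x\<in>UNIV. J x * g x) = 0"
    by (simp add: g_def right_diff_distrib sum_subtractf sum_distrib_right[symmetric] J \<mu>_def)
  have cons: "P (x # xs) = J x * P xs" "G (x # xs) = g x + G xs" for x xs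
    by (simp_all add: P_def G_def)
  have E1: "(\<Sum>xs\<in>seqs n. P xs * G xs) = 0" for n
  proof (induction n)
    case (Suc n)
    have "(\<Sum>xs\<in>seqs (Suc n). P xs * G xs) =
      (\<Sum>x\<in>UNIV. J x * g x * (\<Sum>xs\<in>seqs n. P xs) + J x * (\<Sum>xs\<in>seqs n. P xs * G xs))"
      unfolding sum_seqs_Suc cons sum_distrib_left sum.distrib[symmetric]
      by (intro sum.cong refl) (simp add: algebra_simps)
    then show ?case
      by (simp add: Suc P1 Jg)
  qed (simp add: seqs_0 G_def)
  \<comment> \<open>The cross term has mean zero by \<open>E1\<close>, so each letter adds
    \<open>V\<close> to the second moment.\<close>
  have E2: "(\<Sum>xs\<in>seqs n. P xs * (G xs)\<^sup>2) = real n * V" for n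
  proof (induction n)
    case (Suc n)
    have "(\<Sum>xs\<in>seqs (Suc n). P xs * (G xs)\<^sup>2) =
      (\<Sum>x\<in>UNIV. J x * (g x)\<^sup>2 * (\<Sum>xs\<in>seqs n. P xs) + 2 * J x * g x * (\<Sum>xs\<in>seqs n. P xs * G xs)
        + J x * (\<Sum>xs\<in>seqs n. P xs * (G xs)\<^sup>2))"
      unfolding sum_seqs_Suc cons sum_distrib_left sum.distrib[symmetric]
      by (intro sum.cong refl) (simp add: algebra_simps power2_eq_square)
    also have "\<dots> = V + real n * V"
      by (simp add: Suc P1 E1 sum.distrib sum_distrib_right[symmetric] J V_def)
    finally show ?case
      by (simp add: algebra_simps)
  qed (simp add: seqs_0 G_def)
  define \<delta> where "\<delta> = c - \<mu>"
  have \<delta>: "0 < \<delta>"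
    using d by (simp add: \<delta>_def \<mu>_def)
  have fg: "sum_list (map f xs) = G xs + real (length xs) * \<mu>" for xs
    by (induction xs) (simp_all add: G_def g_def algebra_simps)
  have bound: "(\<Sum>xs\<in>seqs n. P xs * of_bool (real n * c \<le> sum_list (map f xs))) \<le> V / \<delta>\<^sup>2 / real n"
    if n: "0 < n" for n
  proof -
    have "(real n * \<delta>)\<^sup>2 * (\<Sum>xs\<in>seqs n. P xs * of_bool (real n * c \<le> sum_list (map f xs)))
      \<le> (\<Sum>xs\<in>seqs n. P xs * (G xs)\<^sup>2)"
      unfolding sum_distrib_left
    proof (intro sum_mono)
      fix xs :: "'a list"
      assume xs: "xs \<in> seqs n"
      show "(real n * \<delta>)\<^sup>2 * (P xs * of_bool (real n * c \<le> sum_list (map f xs))) \<le> P xs * (G xs)\<^sup>2"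
      proof (cases "real n * c \<le> sum_list (map f xs)")
        case True
        then have "real n * \<delta> \<le> G xs"
          using length_seqs[OF xs] by (simp add: fg \<delta>_def algebra_simps)
        then have "(real n * \<delta>)\<^sup>2 \<le> (G xs)\<^sup>2"
          using \<delta> by (intro power_mono) auto
        then show ?thesis
          using True P0[of xs] by (simp add: mult.commute mult_left_mono)
      qed (simp add: P0)
    qed
    then show ?thesis
      unfolding E2 using n \<delta> by (simp add: field_simps power2_eq_square)
  qed
  have "(\<lambda>n. V / \<delta>\<^sup>2 / real n) \<longlonglongrightarrow> 0"
    by (rule lim_const_over_n)
  then have "\<forall>\<^sub>F n in sequentially. V / \<delta>\<^sup>2 / real n < \<epsilon>"
    using \<epsilon> by (rule order_tendstoD)
  then show ?thesis
    using eventually_gt_at_top[of 0]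
  proof eventually_elim
    case (elim n)
    then show ?case
      using bound[of n] unfolding P_def by linarith
  qed
qed

section \<open>Probability laws of sequences as finite sums\<close>

lemma pmf_bind_finite:
  "pmf (bind_pmf (p :: 'a::finite pmf) f) y = (\<Sum>x\<in>UNIV. pmf p x * pmf (f x) y)"
  unfolding pmf_bind by (subst integral_measure_pmf[of UNIV]) auto

lemma pmf_map_Cons:
  "pmf (map_pmf ((#) x) p) (y # ys) = (if x = y then pmf p ys else 0)"
proof (cases "x = y")
  case True
  have "inj ((#) y)"
    by (simp add: inj_def)
  then show ?thesis
    using True by (simp add: pmf_map_inj')
next
  case False
  then show ?thesis
    by (auto simp: pmf_eq_0_set_pmf)
qed

lemma pmf_replicate_pmf:
  fixes p :: "'a::finite pmf"
  shows "xs \<in> seqs n \<Longrightarrow> pmf (replicate_pmf n p) xs = prod_list (map (pmf p) xs)"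
proof (induction n arbitrary: xs)
  case (Suc n)
  then obtain a as where xs: "xs = a # as" and as: "as \<in> seqs n"
    by (auto simp: seqs_def length_Suc_conv)
  have "replicate_pmf (Suc n) p = bind_pmf p (\<lambda>x. map_pmf ((#) x) (replicate_pmf n p))"
    by (simp add: map_pmf_def)
  then show ?case
    using Suc.IH[OF as] by (simp add: xs pmf_bind_finite pmf_map_Cons if_distrib[where f = "(*) c" for c] cong: if_cong)
qed (simp add: seqs_0)

lemma set_memoryless:
  "length xs = length ss \<Longrightarrow> set_pmf (memoryless W xs ss) \<subseteq> seqs (length ss)"
proof (induction xs ss rule: list_induct2)
  case (Cons x xs s ss)
  then show ?case
    by (auto simp: seqs_def)
qed (simp add: seqs_0)

lemma pmf_memoryless_Cons:
  fixes W :: "'x \<Rightarrow> 's \<Rightarrow> 'y::finite pmf"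
  shows "pmf (memoryless W (x # xs) (s # ss)) (y # ys) = pmf (W x s) y * pmf (memoryless W xs ss) ys"
  by (simp add: pmf_bind_finite pmf_map_Cons if_distrib[where f = "(*) c" for c] cong: if_cong)

lemma pmf_memoryless_append:
  fixes W :: "'x \<Rightarrow> 's \<Rightarrow> 'y::finite pmf"
  assumes "length xs = length ss" "length ys = length ss"
  shows "pmf (memoryless W (xs @ xs') (ss @ ss')) (ys @ ys') =
    pmf (memoryless W xs ss) ys * pmf (memoryless W xs' ss') ys'"
  using assms
proof (induction xs ss arbitrary: ys rule: list_induct2)
  case (Cons x xs s ss)
  then obtain b bs where "ys = b # bs" "length bs = length ss"
    by (auto simp: length_Suc_conv)
  then show ?case
    using Cons.IH[of bs] by (simp add: pmf_memoryless_Cons del: memoryless.simps)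
qed simp

lemma sum_memoryless:
  fixes W :: "'x \<Rightarrow> 's \<Rightarrow> 'y::finite pmf"
  assumes "length xs = n" "length ss = n"
  shows "(\<Sum>ys\<in>seqs n. pmf (memoryless W xs ss) ys) = 1"
  using assms set_memoryless[of xs ss W] by (intro sum_pmf_eq_1) simp_all

text \<open>Replaces the monadic \<open>transmission\<close> by nested finite sums, the form used by
  both the converse and the achievability proof. The length hypothesis matters because
  \<open>memoryless\<close> stops at the shorter of its arguments.\<close>

lemma error_prob_eq:
  fixes pS :: "'s::finite pmf" and W :: "'x \<Rightarrow> 's \<Rightarrow> 'y::finite pmf"
  assumes M: "0 < M" and len: "\<And>m s. length s = n \<Longrightarrow> length (\<phi> m s) = n"
  shows "error_prob pS W n M \<phi> dec =
    (\<Sum>m\<in>{1..M}. \<Sum>s\<in>seqs n. prod_list (map (pmf pS) s) *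
      (\<Sum>y\<in>seqs n. pmf (memoryless W (\<phi> m s) s) y * of_bool (dec y s \<noteq> m))) / real M"
proof -
  let ?E = "{(m, s, y). dec y s \<noteq> m}"
  have rep: "set_pmf (replicate_pmf n pS) \<subseteq> seqs n"
    by (auto simp: set_replicate_pmf seqs_def)
  have Y: "measure_pmf.expectation (map_pmf (\<lambda>y. (m, s, y)) (memoryless W (\<phi> m s) s)) (indicator ?E)
    = (\<Sum>y\<in>seqs n. pmf (memoryless W (\<phi> m s) s) y * of_bool (dec y s \<noteq> m))"
    if "s \<in> seqs n" for m s
  proof -
    have "set_pmf (memoryless W (\<phi> m s) s) \<subseteq> seqs n"
      using set_memoryless[of "\<phi> m s" s W] len[of s m] that by (simp add: seqs_def)
    then show ?thesis
      unfolding integral_map_pmf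
      by (subst integral_measure_pmf[of "seqs n"]) (auto simp: indicator_def of_bool_def intro!: sum.cong)
  qed
  have fin: "finite (set_pmf (map_pmf (\<lambda>y. (m, s, y)) (memoryless W (\<phi> m s) s)))"
    if "s \<in> seqs n" for m s
  proof -
    have "set_pmf (memoryless W (\<phi> m s) s) \<subseteq> seqs n"
      using set_memoryless[of "\<phi> m s" s W] len[of s m] that by (simp add: seqs_def)
    then have "finite (set_pmf (memoryless W (\<phi> m s) s))"
      by (rule finite_subset) simp
    then show ?thesis
      by simp
  qed
  have fin': "finite (set_pmf (bind_pmf (replicate_pmf n pS)
      (\<lambda>s. map_pmf (\<lambda>y. (m, s, y)) (memoryless W (\<phi> m s) s))))" for m
    unfolding set_bind_pmf using rep fin finite_subset[OF rep] by auto
  have S: "measure_pmf.expectation (bind_pmf (replicate_pmf n pS)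
      (\<lambda>s. map_pmf (\<lambda>y. (m, s, y)) (memoryless W (\<phi> m s) s))) (indicator ?E)
    = (\<Sum>s\<in>seqs n. prod_list (map (pmf pS) s) *
      (\<Sum>y\<in>seqs n. pmf (memoryless W (\<phi> m s) s) y * of_bool (dec y s \<noteq> m)))" for m
    by (subst pmf_expectation_bind[of "seqs n"]) (use fin rep Y in \<open>auto simp: pmf_replicate_pmf intro!: sum.cong\<close>)
  have "error_prob pS W n M \<phi> dec = measure_pmf.expectation (transmission pS W n M \<phi>) (indicator ?E)"
    by (simp add: error_prob_def)
  also have "\<dots> = (\<Sum>m\<in>{1..M}. measure_pmf.expectation (bind_pmf (replicate_pmf n pS)
      (\<lambda>s. map_pmf (\<lambda>y. (m, s, y)) (memoryless W (\<phi> m s) s))) (indicator ?E) /\<^sub>R real (card {1..M}))"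
    unfolding transmission_def by (subst pmf_expectation_bind_pmf_of_set) (use M fin' in auto)
  finally show ?thesis
    unfolding S card_atLeastAtMost diff_Suc_1 scaleR_sum_right[symmetric]
    by (simp only: real_scaleR_def divide_inverse_commute)
qed

section \<open>Converse for causal codes\<close>

text \<open>Junk value: \<open>kl w 0 = 0\<close>; only \<open>q > 0\<close>, or \<open>q = 0\<close> with \<open>w = 0\<close>, is meaningful.\<close>

definition kl :: "real \<Rightarrow> real \<Rightarrow> real" where
  "kl w q = w * ln (w / q)"

text \<open>The logarithm of the quotient splits when \<open>w\<close> and \<open>w'\<close> are
  positive; if one of them is zero, both sides vanish. Summed over normalised laws, this is the
  chain rule for divergence.\<close>

lemma kl_mult:
  assumes "0 \<le> w" "0 \<le> w'" "0 < q" "0 < q'"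
  shows "kl (w * w') (q * q') = kl w q * w' + w * kl w' q'"
proof (cases "w = 0 \<or> w' = 0")
  case False
  then have "ln ((w * w') / (q * q')) = ln (w / q) + ln (w' / q')"
    using assms by (simp add: ln_mult ln_div)
  then show ?thesis
    by (simp add: kl_def algebra_simps)
qed (auto simp: kl_def)

text \<open>The bound \<open>ln u \<le> u - 1\<close> at \<open>u = q * exp t / w\<close>. The free
  parameter \<open>t\<close> lets the converse use \<open>ln M\<close> where the decoder is right
  and \<open>0\<close> where it is wrong, which does the work of Fano's inequality.\<close>

lemma kl_ge:
  assumes "0 \<le> w" "0 < q"
  shows "w * t + w - q * exp t \<le> kl w q"
proof (cases "w = 0")
  case False
  then have w: "0 < w"
    using assms by simp
  have "ln (q * exp t / w) \<le> q * exp t / w - 1"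
    using w assms by (intro ln_le_minus_one) simp
  moreover have "ln (q * exp t / w) = t - ln (w / q)"
    using w assms by (simp add: ln_mult ln_div)
  ultimately have "w * (t - ln (w / q)) \<le> w * (q * exp t / w - 1)"
    using w by (intro mult_left_mono) auto
  then show ?thesis
    using w by (simp add: kl_def algebra_simps)
qed (use assms in \<open>simp add: kl_def\<close>)

text \<open>The past states \<open>h\<close> are an explicit argument so that an induction can split
  off the first letter and restart with the longer history.\<close>

fun adaptive :: "('s list \<Rightarrow> 's \<Rightarrow> 'x) \<Rightarrow> 's list \<Rightarrow> 's list \<Rightarrow> 'x list" where
  "adaptive \<Phi> h [] = []"
| "adaptive \<Phi> h (s # ss) = \<Phi> h s # adaptive \<Phi> (h @ [s]) ss"

text \<open>A comparison law for the output block. Its letters depend on the past and current states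
  only, neither on the message nor on past outputs.\<close>

fun output_law :: "('s list \<Rightarrow> 's \<Rightarrow> 'y \<Rightarrow> real) \<Rightarrow> 's list \<Rightarrow> 's list \<Rightarrow> 'y list \<Rightarrow> real" where
  "output_law Q h (s # ss) (y # ys) = Q h s y * output_law Q (h @ [s]) ss ys"
| "output_law Q h _ _ = 1"

lemma length_adaptive [simp]: "length (adaptive \<Phi> h ss) = length ss"
  by (induction ss arbitrary: h) auto

lemma adaptive_eq_map: "adaptive \<Phi> h ss = map (\<lambda>i. \<Phi> (h @ take i ss) (ss ! i)) [0..<length ss]"
  by (induction ss arbitrary: h) (simp_all add: map_upt_Suc del: upt_Suc)

lemma output_law_pos: "(\<And>h s y. 0 < Q h s y) \<Longrightarrow> 0 < output_law Q h ss ys"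
  by (induction Q h ss ys rule: output_law.induct) auto

lemma sum_output_law:
  fixes Q :: "'s list \<Rightarrow> 's \<Rightarrow> 'y::finite \<Rightarrow> real"
  assumes Q: "\<And>h s. (\<Sum>y\<in>UNIV. Q h s y) = 1"
  shows "length ss = n \<Longrightarrow> (\<Sum>ys\<in>seqs n. output_law Q h ss ys) = 1"
proof (induction ss arbitrary: h n)
  case (Cons s ss)
  then show ?case
    by (auto simp: sum_seqs_Suc sum_distrib_left[symmetric] Q)
qed (simp add: seqs_0)

text \<open>Chain rule: given the past states, every letter contributes at most \<open>C\<close>.\<close>

lemma kl_adaptive_le:
  fixes pS :: "'s::finite pmf" and W :: "'x \<Rightarrow> 's \<Rightarrow> 'y::finite pmf"
  assumes Q: "\<And>h s y. 0 < Q h s y" "\<And>h s. (\<Sum>y\<in>UNIV. Q h s y) = 1"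
    and C: "\<And>h. (\<Sum>s\<in>UNIV. pmf pS s * (\<Sum>y\<in>UNIV. kl (pmf (W (\<Phi> h s) s) y) (Q h s y))) \<le> C"
  shows "(\<Sum>s\<in>seqs n. prod_list (map (pmf pS) s) *
    (\<Sum>y\<in>seqs n. kl (pmf (memoryless W (adaptive \<Phi> h s) s) y) (output_law Q h s y))) \<le> real n * C"
proof (induction n arbitrary: h)
  case 0
  then show ?case by (simp add: seqs_0 kl_def)
next
  case (Suc n)
  define A where "A = (\<lambda>s. \<Sum>y\<in>UNIV. kl (pmf (W (\<Phi> h s) s) y) (Q h s y))"
  define B where "B = (\<lambda>h s. \<Sum>y\<in>seqs n. kl (pmf (memoryless W (adaptive \<Phi> h s) s) y) (output_law Q h s y))"
  have step: "(\<Sum>y\<in>seqs (Suc n). kl (pmf (memoryless W (adaptive \<Phi> h (s # ss)) (s # ss)) y)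
      (output_law Q h (s # ss) y)) = A s + B (h @ [s]) ss" if ss: "ss \<in> seqs n" for s ss
  proof -
    let ?w = "\<lambda>y. pmf (W (\<Phi> h s) s) y"
    let ?w' = "\<lambda>ys. pmf (memoryless W (adaptive \<Phi> (h @ [s]) ss) ss) ys"
    have 1: "(\<Sum>ys\<in>seqs n. ?w' ys) = 1"
      by (rule sum_memoryless) (simp_all add: length_seqs[OF ss])
    have 2: "(\<Sum>y\<in>UNIV. ?w y) = 1"
      by (rule sum_pmf_eq_1) auto
    have "(\<Sum>y\<in>seqs (Suc n). kl (pmf (memoryless W (adaptive \<Phi> h (s # ss)) (s # ss)) y)
        (output_law Q h (s # ss) y)) =
      (\<Sum>y\<in>UNIV. \<Sum>ys\<in>seqs n. kl (?w y) (Q h s y) * ?w' ys + ?w y * kl (?w' ys) (output_law Q (h @ [s]) ss ys))"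
      unfolding sum_seqs_Suc adaptive.simps pmf_memoryless_Cons output_law.simps
      by (intro sum.cong refl kl_mult output_law_pos Q) auto
    also have "\<dots> = A s + B (h @ [s]) ss"
      unfolding sum.distrib sum_distrib_left[symmetric] sum_distrib_right[symmetric] 1 2 A_def B_def by simp
    finally show ?thesis .
  qed
  have "(\<Sum>s\<in>seqs (Suc n). prod_list (map (pmf pS) s) *
    (\<Sum>y\<in>seqs (Suc n). kl (pmf (memoryless W (adaptive \<Phi> h s) s) y) (output_law Q h s y)))
    = (\<Sum>s\<in>UNIV. \<Sum>ss\<in>seqs n. pmf pS s * A s * prod_list (map (pmf pS) ss) +
         pmf pS s * (prod_list (map (pmf pS) ss) * B (h @ [s]) ss))"
    unfolding sum_seqs_Suc[of _ n, where 'a = 's]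
    by (intro sum.cong refl, subst step) (auto simp: algebra_simps)
  also have "\<dots> = (\<Sum>s\<in>UNIV. pmf pS s * A s) +
    (\<Sum>s\<in>UNIV. pmf pS s * (\<Sum>ss\<in>seqs n. prod_list (map (pmf pS) ss) * B (h @ [s]) ss))"
    by (simp add: sum.distrib sum_distrib_left[symmetric] sum_seqs_prod_list sum_pmf_eq_1)
  \<comment> \<open>The hypothesis at history \<open>h\<close> bounds the first letter; the
    induction hypothesis at \<open>h @ [s]\<close> bounds the rest.\<close>
  also have "\<dots> \<le> C + (\<Sum>s\<in>UNIV. pmf pS s * (real n * C))"
    using C[of h] Suc.IH unfolding A_def B_def by (intro add_mono sum_mono mult_left_mono) auto
  also have "\<dots> = real (Suc n) * C"
    unfolding sum_distrib_right[symmetric] by (simp add: sum_pmf_eq_1 algebra_simps)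
  finally show ?case .
qed

text \<open>Once message and past states are fixed, the current state enters the input only through
  the one new symbol \<open>f (Suc (length h)) (h @ [\<sigma>])\<close>. This is what gives the
  single-letter condition its form \<open>x (h s)\<close>.\<close>

lemma inputs_c_eq_adaptive:
  assumes "length s = n"
  shows "inputs_c n f g m s = adaptive (\<lambda>h \<sigma>. g (Suc (length h)) m
    (map (\<lambda>i. f i (take i h)) [1..<Suc (length h)] @ [f (Suc (length h)) (h @ [\<sigma>])])) [] s"
proof (rule nth_equalityI)
  fix i
  assume "i < length (inputs_c n f g m s)"
  then have i: "i < n"
    by (simp add: inputs_c_def Let_def del: upt_Suc)
  have 1: "take (Suc i) (map (\<lambda>i. f i (take i s)) [1..<Suc n]) =
      map (\<lambda>j. f j (take j (take i s))) [1..<Suc i] @ [f (Suc i) (take i s @ [s ! i])]"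
  proof -
    have "take (Suc i) (map (\<lambda>i. f i (take i s)) [1..<Suc n]) = map (\<lambda>i. f i (take i s)) [1..<Suc (Suc i)]"
      using i by (simp add: take_map del: upt_Suc)
    also have "\<dots> = map (\<lambda>i. f i (take i s)) [1..<Suc i] @ [f (Suc i) (take (Suc i) s)]"
      by simp
    finally show ?thesis
      using i assms by (simp add: take_Suc_conv_app_nth min_def del: upt_Suc)
  qed
  show "inputs_c n f g m s ! i = adaptive (\<lambda>h \<sigma>. g (Suc (length h)) m
    (map (\<lambda>i. f i (take i h)) [1..<Suc (length h)] @ [f (Suc (length h)) (h @ [\<sigma>])])) [] s ! i"
    using i assms 1 by (simp add: inputs_c_def Let_def adaptive_eq_map del: upt_Suc)
qed (simp add: inputs_c_def Let_def assms del: upt_Suc)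

lemma length_inputs_c: "length (inputs_c n f g m s) = n"
  by (simp add: inputs_c_def Let_def)

text \<open>The law of the code is compared with an output law that does not know the message. The
  divergence is at most \<open>n * C\<close> by the chain rule, and it is large if decoding
  succeeds, since under the comparison law the correct guesses of all messages together have
  probability at most one.\<close>

lemma causal_code_bound:
  fixes pS :: "'s::finite pmf" and W :: "'x2 \<Rightarrow> 's \<Rightarrow> 'y::finite pmf"
    and f :: "('s, 'x1) state_encoder" and g :: "('x1, 'x2) transmitter"
    and Q :: "('s \<Rightarrow> 'x1) \<Rightarrow> 's \<Rightarrow> 'y \<Rightarrow> real"
  assumes Q: "\<And>h s y. 0 < Q h s y" "\<And>h s. (\<Sum>y\<in>UNIV. Q h s y) = 1"
    and C: "\<And>h x. (\<Sum>s\<in>UNIV. pmf pS s * (\<Sum>y\<in>UNIV. kl (pmf (W (x (h s)) s) y) (Q h s y))) \<le> C"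
    and M: "0 < M" and err: "error_prob pS W n M (inputs_c n f g) dec \<le> \<epsilon>"
  shows "(1 - \<epsilon>) * ln (real M) \<le> real n * C + 1"
proof -
  define \<Phi> where "\<Phi> = (\<lambda>m h \<sigma>. g (Suc (length h)) m
    (map (\<lambda>i. f i (take i h)) [1..<Suc (length h)] @ [f (Suc (length h)) (h @ [\<sigma>])]))"
  \<comment> \<open>Given the past, the encoder symbol is a map of the current state; this map
    selects the letter law.\<close>
  define R where "R = (\<lambda>h. Q (\<lambda>\<sigma>. f (Suc (length h)) (h @ [\<sigma>])))"
  define P where "P = (\<lambda>s. prod_list (map (pmf pS) s))"
  define w where "w = (\<lambda>m s y. pmf (memoryless W (inputs_c n f g m s) s) y)"
  define q where "q = (\<lambda>s y. output_law R [] s y)"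
  have P0: "0 \<le> P s" for s
    unfolding P_def by (rule prod_list_map_nonneg) simp
  have P1: "(\<Sum>s\<in>seqs n. P s) = 1"
    by (simp add: P_def sum_seqs_prod_list sum_pmf_eq_1)
  have w1: "(\<Sum>y\<in>seqs n. w m s y) = 1" if "s \<in> seqs n" for m s
    unfolding w_def using that by (intro sum_memoryless) (simp_all add: length_inputs_c length_seqs)
  have R: "0 < R h s y" "(\<Sum>y\<in>UNIV. R h s y) = 1" for h s y
    unfolding R_def using Q by auto
  have q0: "0 < q s y" for s y
    unfolding q_def using R by (intro output_law_pos)
  have q1: "(\<Sum>y\<in>seqs n. q s y) = 1" if "s \<in> seqs n" for s
    unfolding q_def using that R by (intro sum_output_law) (simp_all add: length_seqs)
  have KL: "(\<Sum>s\<in>seqs n. P s * (\<Sum>y\<in>seqs n. kl (w m s y) (q s y))) \<le> real n * C" for m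
  proof -
    have "(\<Sum>s\<in>seqs n. P s * (\<Sum>y\<in>seqs n. kl (w m s y) (q s y))) =
      (\<Sum>s\<in>seqs n. prod_list (map (pmf pS) s) *
        (\<Sum>y\<in>seqs n. kl (pmf (memoryless W (adaptive (\<Phi> m) [] s) s) y) (output_law R [] s y)))"
      unfolding P_def w_def q_def \<Phi>_def
      by (intro sum.cong refl) (simp add: inputs_c_eq_adaptive length_seqs del: upt_Suc)
    also have "\<dots> \<le> real n * C"
    proof (rule kl_adaptive_le)
      fix h :: "'s list"
      show "(\<Sum>s\<in>UNIV. pmf pS s * (\<Sum>y\<in>UNIV. kl (pmf (W (\<Phi> m h s) s) y) (R h s y))) \<le> C"
        unfolding \<Phi>_def R_def
        by (rule C[of "\<lambda>z. g (Suc (length h)) m (map (\<lambda>i. f i (take i h)) [1..<Suc (length h)] @ [z])"])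
    qed (use R in auto)
    finally show ?thesis .
  qed
  have E: "real M * error_prob pS W n M (inputs_c n f g) dec =
      (\<Sum>m\<in>{1..M}. \<Sum>s\<in>seqs n. P s * (\<Sum>y\<in>seqs n. w m s y * of_bool (dec y s \<noteq> m)))"
    using M by (subst error_prob_eq) (simp_all add: length_inputs_c P_def w_def)
  \<comment> \<open>\<open>kl_ge\<close> with \<open>t = ln M\<close> if the decoder is right and
    with \<open>t = 0\<close> otherwise. The terms \<open>w\<close> and \<open>- q\<close> appear in
    both cases so that they cancel after summation over \<open>y\<close>.\<close>
  have point: "ln M * w m s y - ln M * (w m s y * of_bool (dec y s \<noteq> m)) + w m s y
      - real M * (q s y * of_bool (dec y s = m)) - q s y \<le> kl (w m s y) (q s y)" for m s y
    using kl_ge[of "w m s y" "q s y" "ln M"] kl_ge[of "w m s y" "q s y" 0] q0[of s y] M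
    by (cases "dec y s = m") (simp_all add: w_def algebra_simps)
  have "real M * (ln M - ln M * error_prob pS W n M (inputs_c n f g) dec - 1) \<le>
    (\<Sum>m\<in>{1..M}. \<Sum>s\<in>seqs n. P s * (\<Sum>y\<in>seqs n.
      ln M * w m s y - ln M * (w m s y * of_bool (dec y s \<noteq> m)) + w m s y
      - real M * (q s y * of_bool (dec y s = m)) - q s y))" (is "?L \<le> ?S")
  proof -
    \<comment> \<open>Since \<open>q\<close> is the same for all messages and \<open>dec y s\<close>
      equals at most one of them, the sum over \<open>m\<close> costs nothing.\<close>
    have "(\<Sum>m\<in>{1..M}. \<Sum>s\<in>seqs n. P s * (\<Sum>y\<in>seqs n. q s y * of_bool (dec y s = m)))
      = (\<Sum>s\<in>seqs n. P s * (\<Sum>y\<in>seqs n. q s y * (\<Sum>m\<in>{1..M}. of_bool (dec y s = m))))"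
      by (simp only: sum_distrib_left sum.swap[of _ _ "{1..M}"])
    also have "\<dots> \<le> (\<Sum>s\<in>seqs n. P s * (\<Sum>y\<in>seqs n. q s y * 1))"
      using q0 by (intro sum_mono mult_left_mono P0) (auto intro: less_imp_le simp: of_bool_def)
    also have "\<dots> = 1"
      using q1 P1 by simp
    finally have D: "(\<Sum>m\<in>{1..M}. \<Sum>s\<in>seqs n. P s * (\<Sum>y\<in>seqs n. q s y * of_bool (dec y s = m))) \<le> 1" .
    have "?S = (\<Sum>m\<in>{1..M}. \<Sum>s\<in>seqs n. ln M * P s
        - ln M * (P s * (\<Sum>y\<in>seqs n. w m s y * of_bool (dec y s \<noteq> m)))
        - real M * (P s * (\<Sum>y\<in>seqs n. q s y * of_bool (dec y s = m))))"
    proof (intro sum.cong refl)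
      fix m and s :: "'s list"
      assume s: "s \<in> seqs n"
      show "P s * (\<Sum>y\<in>seqs n. ln M * w m s y - ln M * (w m s y * of_bool (dec y s \<noteq> m)) + w m s y
          - real M * (q s y * of_bool (dec y s = m)) - q s y) = ln M * P s
        - ln M * (P s * (\<Sum>y\<in>seqs n. w m s y * of_bool (dec y s \<noteq> m)))
        - real M * (P s * (\<Sum>y\<in>seqs n. q s y * of_bool (dec y s = m)))"
        unfolding sum_subtractf sum.distrib sum_distrib_left[symmetric] w1[OF s] q1[OF s]
        by (simp only: algebra_simps)
    qed
    also have "\<dots> = real M * ln M - ln M * (real M * error_prob pS W n M (inputs_c n f g) dec)
        - real M * (\<Sum>m\<in>{1..M}. \<Sum>s\<in>seqs n. P s * (\<Sum>y\<in>seqs n. q s y * of_bool (dec y s = m)))"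
      unfolding E sum_subtractf sum_distrib_left[symmetric] P1 by simp
    finally have "?S = \<dots>" .
    then show ?thesis
      using mult_left_mono[OF D of_nat_0_le_iff[of M]] by (simp only: right_diff_distrib mult_1_right) (simp only: mult_ac)
  qed
  also have "\<dots> \<le> (\<Sum>m\<in>{1..M}. \<Sum>s\<in>seqs n. P s * (\<Sum>y\<in>seqs n. kl (w m s y) (q s y)))"
    using point by (intro sum_mono mult_left_mono P0)
  also have "\<dots> \<le> real M * (real n * C)"
    using sum_mono[of "{1..M}", OF KL] by simp
  finally have "ln M - ln M * error_prob pS W n M (inputs_c n f g) dec - 1 \<le> real n * C"
    using M by simp
  moreover have "ln M * error_prob pS W n M (inputs_c n f g) dec \<le> ln M * \<epsilon>"
    using err M by (intro mult_left_mono) simp_all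
  ultimately show ?thesis
    by (simp add: algebra_simps)
qed

section \<open>From code length to rate\<close>

lemma num_messages_pos: "0 < num_messages n R"
  by (simp add: num_messages_def)

lemma ln_num_messages_ge: "real n * (R * ln 2) \<le> ln (real (num_messages n R))"
proof -
  have "2 powr (real n * R) \<le> real (num_messages n R)"
    unfolding num_messages_def by linarith
  then have "ln (2 powr (real n * R)) \<le> ln (real (num_messages n R))"
    by (intro ln_mono) (simp_all add: num_messages_pos)
  then show ?thesis
    by (simp add: ln_powr mult_ac)
qed

text \<open>Divide \<open>causal_code_bound\<close> by \<open>n\<close> and let \<open>n\<close>
  grow and the error shrink. The condition \<open>C\<close> is the dual form of capacity: one law
  \<open>Q h\<close> must serve all input maps \<open>x\<close>, so that no input distribution has
  to be optimised.\<close>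

theorem causal_converse:
  fixes pS :: "'s::finite pmf" and W :: "'x2 \<Rightarrow> 's \<Rightarrow> 'y::finite pmf"
    and Q :: "('s \<Rightarrow> 'x1) \<Rightarrow> 's \<Rightarrow> 'y \<Rightarrow> real"
  assumes Q: "\<And>h s y. 0 < Q h s y" "\<And>h s. (\<Sum>y\<in>UNIV. Q h s y) = 1"
    and C: "\<And>h x. (\<Sum>s\<in>UNIV. pmf pS s * (\<Sum>y\<in>UNIV. kl (pmf (W (x (h s)) s) y) (Q h s y))) \<le> C"
    and ach: "achievable_c TYPE('x1) pS W R"
  shows "R * ln 2 \<le> C"
proof (rule ccontr)
  define D where "D = R * ln 2"
  assume "\<not> R * ln 2 \<le> C"
  then have DC: "C < D"
    by (simp add: D_def)
  have D: "0 \<le> D"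
    using ach by (simp add: D_def achievable_c_def)
  \<comment> \<open>The error costs at most half of the gap \<open>D - C\<close>; the cap
    \<open>1 / 2\<close> keeps \<open>1 - \<epsilon>\<close> positive. Below, \<open>N\<close> is
    chosen so that the other half exceeds the additive constant \<open>1\<close>.\<close>
  define \<epsilon> where "\<epsilon> = min (1 / 2) ((D - C) / (2 * (D + 1)))"
  have \<epsilon>: "0 < \<epsilon>" "\<epsilon> \<le> 1 / 2"
    using D DC unfolding \<epsilon>_def by (simp, intro min.cobounded1)
  have \<epsilon>': "\<epsilon> \<le> (D - C) / (2 * (D + 1))"
    unfolding \<epsilon>_def by (rule min.cobounded2)
  have "\<epsilon> * D \<le> \<epsilon> * (D + 1)"
    using \<epsilon> by simp
  also have "\<dots> \<le> (D - C) / 2"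
    using \<epsilon>' D by (simp add: field_simps)
  finally have \<epsilon>D: "\<epsilon> * D \<le> (D - C) / 2" .
  obtain N where N: "2 / (D - C) < real N"
    using reals_Archimedean2 by blast
  obtain n f g dec where n: "N \<le> n" and
    "error_prob pS W n (num_messages n R) (inputs_c n (f :: ('s, 'x1) state_encoder) g) dec \<le> \<epsilon>"
    using ach \<epsilon>(1) unfolding achievable_c_def by blast
  from causal_code_bound[OF Q C num_messages_pos this(2)]
  have "(1 - \<epsilon>) * ln (real (num_messages n R)) \<le> real n * C + 1" .
  moreover have "(1 - \<epsilon>) * (real n * D) \<le> (1 - \<epsilon>) * ln (real (num_messages n R))"
    using \<epsilon>(2) ln_num_messages_ge[of n R] by (intro mult_left_mono) (auto simp: D_def)
  ultimately have "real n * (D - \<epsilon> * D - C) \<le> 1"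
    by (simp add: algebra_simps)
  moreover have "real n * ((D - C) / 2) \<le> real n * (D - \<epsilon> * D - C)"
    using \<epsilon>D by (intro mult_left_mono) auto
  moreover have "1 < real N * ((D - C) / 2)"
    using N DC by (simp add: field_simps)
  moreover have "real N * ((D - C) / 2) \<le> real n * ((D - C) / 2)"
    using n DC by (intro mult_right_mono) auto
  ultimately show False
    by linarith
qed

section \<open>Channel and source coding\<close>

text \<open>
  Feinstein's greedy argument: if no further codeword fits, then the decoding sets chosen so far
  already exhaust the typical pairs, which takes about \<open>\<gamma>\<close> of them.
\<close>

lemma feinstein:
  fixes P :: "'a \<Rightarrow> real" and V :: "'a \<Rightarrow> 'b \<Rightarrow> real"
  assumes fin: "finite A" "finite B"
    and P: "\<And>a. a \<in> A \<Longrightarrow> 0 \<le> P a" "(\<Sum>a\<in>A. P a) = 1"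
    and V: "\<And>a b. a \<in> A \<Longrightarrow> b \<in> B \<Longrightarrow> 0 \<le> V a b" "\<And>a. a \<in> A \<Longrightarrow> (\<Sum>b\<in>B. V a b) = 1"
    and \<gamma>: "0 < \<gamma>"
    and good: "1 - \<delta> \<le> (\<Sum>a\<in>A. P a * (\<Sum>b\<in>B. V a b * of_bool (\<gamma> * (\<Sum>a'\<in>A. P a' * V a' b) < V a b)))"
    and M: "\<delta> + real M / \<gamma> \<le> \<epsilon>"
  shows "\<exists>c D. (\<forall>j\<in>{1..M}. c j \<in> A \<and> D j \<subseteq> B \<and> 1 - \<epsilon> \<le> (\<Sum>b\<in>D j. V (c j) b)) \<and>
    disjoint_family_on D {1..M}"
proof -
  define q where "q = (\<lambda>b. \<Sum>a\<in>A. P a * V a b)"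
  define G where "G = (\<lambda>a. {b \<in> B. \<gamma> * q b < V a b})"
  have GB: "G a \<subseteq> B" for a
    by (auto simp: G_def)
  have finG: "finite (G a)" for a
    using GB fin(2) finite_subset by blast
  have good': "1 - \<delta> \<le> (\<Sum>a\<in>A. P a * (\<Sum>b\<in>G a. V a b))"
  proof -
    have "(\<Sum>b\<in>B. V a b * of_bool (\<gamma> * q b < V a b)) = (\<Sum>b\<in>G a. V a b)" for a
      unfolding G_def using fin(2) by (intro sum.mono_neutral_cong_right) auto
    then show ?thesis
      using good unfolding q_def by simp
  qed
  \<comment> \<open>On \<open>G a\<close> the output law \<open>q\<close> is below
    \<open>V a\<close> by the factor \<open>\<gamma>\<close>, so a decoding set has small
    \<open>q\<close> mass.\<close>
  have q_le: "(\<Sum>b\<in>E. q b) \<le> 1 / \<gamma>" if "a \<in> A" "E \<subseteq> G a" for a E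
  proof -
    have "(\<Sum>b\<in>E. q b) \<le> (\<Sum>b\<in>E. V a b / \<gamma>)"
      using that \<gamma> by (intro sum_mono) (auto simp: G_def field_simps)
    also have "\<dots> \<le> (\<Sum>b\<in>B. V a b / \<gamma>)"
      using that GB[of a] fin V(1) \<gamma> by (intro sum_mono2) auto
    also have "\<dots> = 1 / \<gamma>"
      using V(2)[OF that(1)] by (simp add: sum_divide_distrib[symmetric])
    finally show ?thesis .
  qed
  \<comment> \<open>The induction keeps the decoding sets inside \<open>G (c j)\<close>, which
    \<open>q_le\<close> requires.\<close>
  have "\<exists>c D. (\<forall>j\<in>{1..M}. c j \<in> A \<and> D j \<subseteq> G (c j) \<and> 1 - \<epsilon> \<le> (\<Sum>b\<in>D j. V (c j) b)) \<and>
    disjoint_family_on D {1..M}"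
    using M
  proof (induction M)
    case 0
    show ?case by (auto simp: disjoint_family_on_def)
  next
    case (Suc M)
    have lt: "\<delta> + real M / \<gamma> < \<delta> + real (Suc M) / \<gamma>"
      using \<gamma> by (simp add: divide_strict_right_mono)
    then have "\<delta> + real M / \<gamma> \<le> \<epsilon>"
      using Suc.prems by linarith
    from Suc.IH[OF this] obtain c D where cD: "\<And>j. j \<in> {1..M} \<Longrightarrow> c j \<in> A" "\<And>j. j \<in> {1..M} \<Longrightarrow> D j \<subseteq> G (c j)"
      "\<And>j. j \<in> {1..M} \<Longrightarrow> 1 - \<epsilon> \<le> (\<Sum>b\<in>D j. V (c j) b)" and dis: "disjoint_family_on D {1..M}"
      by blast
    define D0 where "D0 = (\<Union>j\<in>{1..M}. D j)"
    have D0: "D0 \<subseteq> B"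
      using subset_trans[OF cD(2) GB] unfolding D0_def by (rule UN_least)
    then have finD0: "finite D0"
      using fin(2) by (rule finite_subset)
    \<comment> \<open>Otherwise each \<open>G a\<close> has \<open>V a\<close> mass below
      \<open>1 - \<epsilon>\<close> outside \<open>D0\<close>. Averaging over \<open>P\<close> gives
      \<open>1 - \<delta> \<le> 1 - \<epsilon> + q(D0)\<close>, but
      \<open>q(D0) \<le> M / \<gamma> < \<epsilon> - \<delta>\<close>.\<close>
    have "\<exists>a\<in>A. 1 - \<epsilon> \<le> (\<Sum>b\<in>G a - D0. V a b)"
    proof (rule ccontr)
      assume "\<not> ?thesis"
      then have less: "(\<Sum>b\<in>G a - D0. V a b) < 1 - \<epsilon>" if "a \<in> A" for a
        using that by force
      have "(\<Sum>a\<in>A. P a * (\<Sum>b\<in>G a. V a b)) \<le> (\<Sum>a\<in>A. P a * ((1 - \<epsilon>) + (\<Sum>b\<in>D0. V a b)))"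
      proof (intro sum_mono mult_left_mono P)
        fix a
        assume a: "a \<in> A"
        have "(\<Sum>b\<in>G a. V a b) = (\<Sum>b\<in>G a - D0. V a b) + (\<Sum>b\<in>G a \<inter> D0. V a b)"
          using sum.Int_Diff[OF finG, of "V a" a D0] by simp
        moreover have "(\<Sum>b\<in>G a \<inter> D0. V a b) \<le> (\<Sum>b\<in>D0. V a b)"
          using D0 finD0 V(1)[OF a] by (intro sum_mono2) auto
        ultimately show "(\<Sum>b\<in>G a. V a b) \<le> (1 - \<epsilon>) + (\<Sum>b\<in>D0. V a b)"
          using less[OF a] by linarith
      qed
      also have "\<dots> = (1 - \<epsilon>) + (\<Sum>b\<in>D0. q b)"
        unfolding q_def sum.swap[of _ A D0] by (simp add: algebra_simps sum.distrib sum_subtractf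
            sum_distrib_left[symmetric] P)
      also have "(\<Sum>b\<in>D0. q b) = (\<Sum>j\<in>{1..M}. \<Sum>b\<in>D j. q b)"
        unfolding D0_def using dis finite_subset[OF cD(2) finG]
        by (intro sum.UNION_disjoint) (simp, blast, unfold disjoint_family_on_def, blast)
      also have "\<dots> \<le> (\<Sum>j\<in>{1..M}. 1 / \<gamma>)"
        using cD by (intro sum_mono q_le) auto
      finally show False
        using good' lt Suc.prems by simp
    qed
    then obtain a where a: "a \<in> A" "1 - \<epsilon> \<le> (\<Sum>b\<in>G a - D0. V a b)"
      by blast
    have "(\<forall>j\<in>{1..Suc M}. (c(Suc M := a)) j \<in> A \<and> (D(Suc M := G a - D0)) j \<subseteq> G ((c(Suc M := a)) j) \<and>
        1 - \<epsilon> \<le> (\<Sum>b\<in>(D(Suc M := G a - D0)) j. V ((c(Suc M := a)) j) b)) \<and>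
      disjoint_family_on (D(Suc M := G a - D0)) {1..Suc M}"
    proof
      show "disjoint_family_on (D(Suc M := G a - D0)) {1..Suc M}"
        unfolding disjoint_family_on_def
      proof (intro ballI impI)
        fix i j
        assume ij: "i \<in> {1..Suc M}" "j \<in> {1..Suc M}" "i \<noteq> j"
        consider "i \<in> {1..M}" "j \<in> {1..M}" | "i = Suc M" "j \<in> {1..M}" | "j = Suc M" "i \<in> {1..M}"
          using ij by (auto simp: le_Suc_eq)
        then show "(D(Suc M := G a - D0)) i \<inter> (D(Suc M := G a - D0)) j = {}"
        proof cases
          case 1
          then have "D i \<inter> D j = {}"
            using dis ij(3) unfolding disjoint_family_on_def by blast
          then show ?thesis
            using 1 by simp
        qed (auto simp: D0_def)
      qed
    next
      show "\<forall>j\<in>{1..Suc M}. (c(Suc M := a)) j \<in> A \<and> (D(Suc M := G a - D0)) j \<subseteq> G ((c(Suc M := a)) j) \<and>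
        1 - \<epsilon> \<le> (\<Sum>b\<in>(D(Suc M := G a - D0)) j. V ((c(Suc M := a)) j) b)"
      proof
        fix j
        assume "j \<in> {1..Suc M}"
        then consider "j \<in> {1..M}" | "j = Suc M"
          by (auto simp: le_Suc_eq)
        then show "(c(Suc M := a)) j \<in> A \<and> (D(Suc M := G a - D0)) j \<subseteq> G ((c(Suc M := a)) j) \<and>
          1 - \<epsilon> \<le> (\<Sum>b\<in>(D(Suc M := G a - D0)) j. V ((c(Suc M := a)) j) b)"
        proof cases
          case 1
          then show ?thesis
            using cD[OF 1] by simp
        next
          case 2
          then show ?thesis
            using a by simp
        qed
      qed
    qed
    then show ?case
      by blast
  qed
  then show ?thesis
    using GB by (meson subset_trans)
qed

section \<open>Channel coding for memoryless channels\<close>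

lemma prod_list_zip_mult:
  fixes P :: "'a \<Rightarrow> real" and V :: "'a \<Rightarrow> 'b \<Rightarrow> real"
  assumes "length as = length bs"
  shows "prod_list (map (\<lambda>(a, b). P a * V a b) (zip as bs)) =
    prod_list (map P as) * prod_list (map (\<lambda>(a, b). V a b) (zip as bs))"
  using assms by (induction as bs rule: list_induct2) simp_all

lemma sum_prod_list_channel:
  fixes P :: "'a::finite \<Rightarrow> real" and V :: "'a \<Rightarrow> 'b \<Rightarrow> real"
  assumes "bs \<in> seqs n"
  shows "(\<Sum>as\<in>seqs n. prod_list (map P as) * prod_list (map (\<lambda>(a, b). V a b) (zip as bs))) =
    prod_list (map (\<lambda>b. \<Sum>a\<in>UNIV. P a * V a b) bs)"
  using assms
proof (induction n arbitrary: bs)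
  case (Suc n)
  then obtain b bs' where bs: "bs = b # bs'" "bs' \<in> seqs n"
    by (auto simp: seqs_def length_Suc_conv)
  have "(\<Sum>as\<in>seqs (Suc n). prod_list (map P as) * prod_list (map (\<lambda>(a, b). V a b) (zip as bs))) =
    (\<Sum>a\<in>UNIV. P a * V a b * (\<Sum>as\<in>seqs n. prod_list (map P as) *
      prod_list (map (\<lambda>(a, b). V a b) (zip as bs'))))"
    unfolding sum_seqs_Suc bs sum_distrib_left by (intro sum.cong refl) simp
  then show ?case
    by (simp add: Suc.IH[OF bs(2)] sum_distrib_right[symmetric] bs(1))
qed (simp add: seqs_0)

lemma sum_prod_list_zip:
  fixes V :: "'a \<Rightarrow> 'b::finite \<Rightarrow> real"
  assumes "as \<in> seqs n" "\<And>a. (\<Sum>b\<in>UNIV. V a b) = 1"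
  shows "(\<Sum>bs\<in>seqs n. prod_list (map (\<lambda>(a, b). V a b) (zip as bs))) = 1"
  using assms(1)
proof (induction n arbitrary: as)
  case (Suc n)
  then obtain a as' where as: "as = a # as'" "as' \<in> seqs n"
    by (auto simp: seqs_def length_Suc_conv)
  then show ?case
    by (simp add: sum_seqs_Suc sum_distrib_left[symmetric] Suc.IH assms(2))
qed (simp add: seqs_0)

text \<open>For i.i.d. inputs of law \<open>P\<close>, the information density exceeds
  \<open>n * r'\<close> with probability near one for any \<open>r'\<close> below the mutual
  information. Feinstein's argument with threshold \<open>exp (n * r')\<close> then yields the code,
  because \<open>r < r'\<close> makes \<open>M / \<gamma>\<close> vanish.\<close>

theorem dmc_coding:
  fixes P :: "'a::finite \<Rightarrow> real" and V :: "'a \<Rightarrow> 'b::finite \<Rightarrow> real"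
  assumes P: "\<And>a. 0 \<le> P a" "(\<Sum>a\<in>UNIV. P a) = 1"
    and V: "\<And>a b. 0 \<le> V a b" "\<And>a. (\<Sum>b\<in>UNIV. V a b) = 1"
    and r: "r < (\<Sum>a\<in>UNIV. \<Sum>b\<in>UNIV. P a * kl (V a b) (\<Sum>a'\<in>UNIV. P a' * V a' b))"
    and \<epsilon>: "0 < \<epsilon>"
  shows "\<forall>\<^sub>F n in sequentially. \<forall>M. real M \<le> exp (real n * r) \<longrightarrow>
    (\<exists>c D. (\<forall>j\<in>{1..M}. c j \<in> seqs n \<and> D j \<subseteq> seqs n \<and>
        1 - \<epsilon> \<le> (\<Sum>bs\<in>D j. prod_list (map (\<lambda>(a, b). V a b) (zip (c j) bs)))) \<and>
      disjoint_family_on D {1..M})"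
proof -
  define q where "q = (\<lambda>b. \<Sum>a\<in>UNIV. P a * V a b)"
  define J where "J = (\<lambda>(a, b). P a * V a b)"
  \<comment> \<open>Negated information density, because \<open>chebyshev_seqs\<close> controls
    upward deviations.\<close>
  define f where "f = (\<lambda>(a, b). - ln (V a b / q b))"
  define Vn where "Vn = (\<lambda>as bs. prod_list (map (\<lambda>(a, b). V a b) (zip as bs)))"
  obtain r' where r': "r < r'" "r' < (\<Sum>a\<in>UNIV. \<Sum>b\<in>UNIV. P a * kl (V a b) (q b))"
    using dense[OF r] by (auto simp: q_def)
  have J0: "0 \<le> J z" for z
    by (simp add: J_def P V split: prod.split)
  have sum_pair: "(\<Sum>z\<in>UNIV. h z) = (\<Sum>a\<in>UNIV. \<Sum>b\<in>UNIV. h (a, b))" for h :: "'a \<times> 'b \<Rightarrow> real"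
    using sum.cartesian_product[of "\<lambda>a b. h (a, b)" UNIV UNIV] by simp
  have J1: "(\<Sum>z\<in>UNIV. J z) = 1"
    by (simp add: sum_pair J_def sum_distrib_left[symmetric] V P)
  have q0: "0 \<le> q b" for b
    unfolding q_def using P V by (intro sum_nonneg) auto
  have "(\<Sum>z\<in>UNIV. J z * f z) = - (\<Sum>a\<in>UNIV. \<Sum>b\<in>UNIV. P a * kl (V a b) (q b))"
    by (simp add: sum_pair J_def f_def kl_def sum_negf mult.assoc)
  then have "(\<Sum>z\<in>UNIV. J z * f z) < - r'"
    using r' by simp
  from chebyshev_seqs[OF J0 J1 this, of "\<epsilon> / 2"] \<epsilon>
  have ev1: "\<forall>\<^sub>F n in sequentially.
    (\<Sum>zs\<in>seqs n. prod_list (map J zs) * of_bool (real n * (- r') \<le> sum_list (map f zs))) \<le> \<epsilon> / 2"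
    by simp
  have "(\<lambda>n. exp (r - r') ^ n) \<longlonglongrightarrow> 0"
    using r' by (intro LIMSEQ_power_zero) simp
  then have ev2: "\<forall>\<^sub>F n in sequentially. exp (r - r') ^ n < \<epsilon> / 2"
    using \<epsilon> by (intro order_tendstoD) auto
  \<comment> \<open>The logarithm in \<open>f\<close> takes a default value where
    \<open>V a b\<close> or \<open>q b\<close> vanishes; such pairs have joint weight zero.\<close>
  have pos: "0 < V a b" "0 < q b" if "J (a, b) \<noteq> 0" for a b
  proof -
    have "0 < P a * V a b"
      using that P(1)[of a] V(1)[of a b] by (simp add: J_def less_le)
    moreover have "P a * V a b \<le> q b"
      unfolding q_def using P V by (intro member_le_sum) auto
    ultimately show "0 < V a b" "0 < q b"
      using P(1)[of a] V(1)[of a b] less_le_trans[of 0 "P a * V a b" "q b"]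
      by (auto simp: zero_less_mult_iff)
  qed
  have density: "Vn (map fst zs) (map snd zs) =
      exp (- sum_list (map f zs)) * prod_list (map q (map snd zs))"
    if "prod_list (map J zs) \<noteq> 0" for zs
    using that
  proof (induction zs)
    case (Cons z zs)
    obtain a b where z: "z = (a, b)"
      by (cases z)
    have "V a b = exp (- f (a, b)) * q b"
      using pos[of a b] Cons.prems by (simp add: z f_def)
    moreover have "exp (- (x + y)) = exp (- x) * exp (- y)" for x y :: real
      by (simp add: exp_add[symmetric])
    moreover have "Vn (map fst zs) (map snd zs) =
        exp (- sum_list (map f zs)) * prod_list (map q (map snd zs))"
      using Cons by simp
    ultimately show ?case
      by (simp add: z Vn_def)
  qed (simp add: Vn_def)
  show ?thesis
    using ev1 ev2
  proof eventually_elim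
    case (elim n)
    show ?case
    proof (intro allI impI)
      fix M
      assume M: "real M \<le> exp (real n * r)"
      define \<gamma> where "\<gamma> = exp (real n * r')"
      have "real M / \<gamma> \<le> exp (real n * r) / exp (real n * r')"
        using M by (simp add: \<gamma>_def divide_right_mono)
      also have "\<dots> = exp (r - r') ^ n"
        by (simp add: exp_diff[symmetric] exp_of_nat_mult[symmetric] algebra_simps)
      finally have M\<gamma>: "\<epsilon> / 2 + real M / \<gamma> \<le> \<epsilon>"
        using elim(2) by simp
      have Vn0: "0 \<le> Vn as bs" for as bs
        unfolding Vn_def by (rule prod_list_map_nonneg) (use V in auto)
      have Pn0: "0 \<le> prod_list (map P as)" for as
        by (rule prod_list_map_nonneg) (rule P)
      have "1 - \<epsilon> / 2 \<le> (\<Sum>zs\<in>seqs n. prod_list (map J zs)) -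
          (\<Sum>zs\<in>seqs n. prod_list (map J zs) * of_bool (real n * (- r') \<le> sum_list (map f zs)))"
        using elim(1) by (simp add: sum_seqs_prod_list J1)
      also have "\<dots> = (\<Sum>as\<in>seqs n. \<Sum>bs\<in>seqs n. prod_list (map J (zip as bs)) *
          of_bool (sum_list (map f (zip as bs)) < - (real n * r')))"
        unfolding sum_subtractf[symmetric]
        by (subst sum_seqs_zip[where F = "\<lambda>zs. prod_list (map J zs) * of_bool (sum_list (map f zs) < - (real n * r'))"])
          (intro sum.cong refl, simp add: of_bool_def)
      also have "\<dots> \<le> (\<Sum>as\<in>seqs n. \<Sum>bs\<in>seqs n. prod_list (map P as) *
          (Vn as bs * of_bool (\<gamma> * prod_list (map q bs) < Vn as bs)))"
      proof (intro sum_mono)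
        fix as :: "'a list" and bs :: "'b list"
        assume "as \<in> seqs n" "bs \<in> seqs n"
        then have l: "length as = length bs"
          by (simp add: seqs_def)
        have eq: "prod_list (map J (zip as bs)) = prod_list (map P as) * Vn as bs"
          unfolding J_def Vn_def by (rule prod_list_zip_mult[OF l])
        show "prod_list (map J (zip as bs)) * of_bool (sum_list (map f (zip as bs)) < - (real n * r'))
          \<le> prod_list (map P as) * (Vn as bs * of_bool (\<gamma> * prod_list (map q bs) < Vn as bs))"
        proof (cases "prod_list (map J (zip as bs)) = 0 \<or> - (real n * r') \<le> sum_list (map f (zip as bs))")
          case True
          then show ?thesis
            using Vn0 Pn0 by auto
        next
          case False
          have D: "Vn as bs = exp (- sum_list (map f (zip as bs))) * prod_list (map q bs)"
            using density[of "zip as bs"] False l by simp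
          have "prod_list (map q bs) \<noteq> 0"
            using False D eq by auto
          then have "0 < prod_list (map q bs)"
            using prod_list_map_nonneg[of q bs] q0 by (simp add: less_le)
          then have "\<gamma> * prod_list (map q bs) < Vn as bs"
            unfolding D \<gamma>_def using False by simp
          then show ?thesis
            by (simp add: eq Vn0 Pn0)
        qed
      qed
      also have "\<dots> = (\<Sum>as\<in>seqs n. prod_list (map P as) *
          (\<Sum>bs\<in>seqs n. Vn as bs * of_bool (\<gamma> * prod_list (map q bs) < Vn as bs)))"
        by (simp only: sum_distrib_left)
      also have "\<dots> = (\<Sum>as\<in>seqs n. prod_list (map P as) *
          (\<Sum>bs\<in>seqs n. Vn as bs * of_bool (\<gamma> * (\<Sum>as'\<in>seqs n. prod_list (map P as') * Vn as' bs) < Vn as bs)))"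
        unfolding Vn_def q_def
        by (intro sum.cong refl arg_cong2[of _ _ _ _ "(*)"]) (simp add: sum_prod_list_channel)
      finally show "\<exists>c D. (\<forall>j\<in>{1..M}. c j \<in> seqs n \<and> D j \<subseteq> seqs n \<and>
          1 - \<epsilon> \<le> (\<Sum>bs\<in>D j. prod_list (map (\<lambda>(a, b). V a b) (zip (c j) bs)))) \<and>
          disjoint_family_on D {1..M}"
        using M\<gamma> unfolding Vn_def[symmetric]
        by (intro feinstein[where P = "\<lambda>as. prod_list (map P as)" and \<gamma> = \<gamma> and \<delta> = "\<epsilon> / 2"])
          (use Pn0 Vn0 in \<open>auto simp: \<gamma>_def sum_seqs_prod_list P Vn_def sum_prod_list_zip V\<close>)
    qed
  qed
qed

text \<open>
  With the states known to transmitter and decoder, a channel letter is a map from states to inputs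
  (a Shannon strategy) and the output is the pair of state and channel output.
\<close>

lemma strategy_coding:
  fixes pS :: "'s::finite pmf" and W :: "'x::finite \<Rightarrow> 's \<Rightarrow> 'y::finite pmf" and p :: "'s \<Rightarrow> 'x pmf"
  assumes r: "r < (\<Sum>s\<in>UNIV. pmf pS s * (\<Sum>x\<in>UNIV. pmf (p s) x *
      (\<Sum>y\<in>UNIV. kl (pmf (W x s) y) (\<Sum>x'\<in>UNIV. pmf (p s) x' * pmf (W x' s) y))))"
    and \<epsilon>: "0 < \<epsilon>"
  shows "\<forall>\<^sub>F n in sequentially. \<forall>M. real M \<le> exp (real n * r) \<longrightarrow>
    (\<exists>(c :: nat \<Rightarrow> ('s \<Rightarrow> 'x) list) D. (\<forall>j\<in>{1..M}. c j \<in> seqs n \<and> D j \<subseteq> seqs n \<and>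
        1 - \<epsilon> \<le> (\<Sum>bs\<in>D j. prod_list (map (\<lambda>(t, s, y). pmf pS s * pmf (W (t s) s) y) (zip (c j) bs)))) \<and>
      disjoint_family_on D {1..M})"
proof -
  \<comment> \<open>A random strategy with independent components. Since the channel reads only
    \<open>t s\<close>, only the marginal \<open>p s\<close> matters.\<close>
  define P where "P = (\<lambda>t. pmf (Pi_pmf UNIV undefined p) t)"
  define V where "V = (\<lambda>t (s, y). pmf pS s * pmf (W (t s) s) y)"
  define q where "q = (\<lambda>s y. \<Sum>x'\<in>UNIV. pmf (p s) x' * pmf (W x' s) y)"
  have sum_pair: "(\<Sum>z\<in>UNIV. h z) = (\<Sum>a\<in>UNIV. \<Sum>b\<in>UNIV. h (a, b))" for h :: "'s \<times> 'y \<Rightarrow> real"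
    using sum.cartesian_product[of "\<lambda>a b. h (a, b)" UNIV UNIV] by simp
  have marginal: "(\<Sum>t\<in>UNIV. P t * F (t s)) = (\<Sum>x\<in>UNIV. pmf (p s) x * F x)" for s and F :: "'x \<Rightarrow> real"
  proof -
    have "(\<Sum>t\<in>UNIV. P t * F (t s)) = measure_pmf.expectation (Pi_pmf UNIV undefined p) (\<lambda>t. F (t s))"
      by (subst integral_measure_pmf[of UNIV]) (auto simp: P_def)
    also have "\<dots> = measure_pmf.expectation (map_pmf (\<lambda>t. t s) (Pi_pmf UNIV undefined p)) F"
      by simp
    also have "\<dots> = (\<Sum>x\<in>UNIV. pmf (p s) x * F x)"
      by (subst Pi_pmf_component) (auto simp: integral_measure_pmf[of UNIV])
    finally show ?thesis .
  qed
  have q: "(\<Sum>t\<in>UNIV. P t * V t (s, y)) = pmf pS s * q s y" for s y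
    using marginal[of "\<lambda>x. pmf (W x s) y" s]
    by (simp add: V_def q_def mult.left_commute[of _ "pmf pS s"] sum_distrib_left[symmetric])
  \<comment> \<open>The state probability cancels in the quotient; where it is zero, both sides are
    zero.\<close>
  have kl: "kl (V t (s, y)) (pmf pS s * q s y) = pmf pS s * kl (pmf (W (t s) s) y) (q s y)" for t s y
    by (simp add: V_def kl_def)
  have "(\<Sum>t\<in>UNIV. \<Sum>b\<in>UNIV. P t * kl (V t b) (\<Sum>t'\<in>UNIV. P t' * V t' b)) =
    (\<Sum>s\<in>UNIV. pmf pS s * (\<Sum>t\<in>UNIV. P t * (\<Sum>y\<in>UNIV. kl (pmf (W (t s) s) y) (q s y))))"
    unfolding sum_pair q kl sum.swap[of _ "UNIV :: ('s \<Rightarrow> 'x) set"] sum_distrib_left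
    by (intro sum.cong refl) (simp add: mult_ac)
  also have "\<dots> = (\<Sum>s\<in>UNIV. pmf pS s * (\<Sum>x\<in>UNIV. pmf (p s) x * (\<Sum>y\<in>UNIV. kl (pmf (W x s) y) (q s y))))"
    by (simp add: marginal[of "\<lambda>x. \<Sum>y\<in>UNIV. kl (pmf (W x s) y) (q s y)" s for s])
  finally have r': "r < (\<Sum>t\<in>UNIV. \<Sum>b\<in>UNIV. P t * kl (V t b) (\<Sum>t'\<in>UNIV. P t' * V t' b))"
    using r by (simp add: q_def)
  have "\<forall>\<^sub>F n in sequentially. \<forall>M. real M \<le> exp (real n * r) \<longrightarrow>
    (\<exists>c D. (\<forall>j\<in>{1..M}. c j \<in> seqs n \<and> D j \<subseteq> seqs n \<and>
        1 - \<epsilon> \<le> (\<Sum>bs\<in>D j. prod_list (map (\<lambda>(a, b). V a b) (zip (c j) bs)))) \<and>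
      disjoint_family_on D {1..M})"
    using r' \<epsilon> by (intro dmc_coding)
      (auto simp: P_def V_def sum_pair sum_distrib_left[symmetric] sum_pmf_eq_1 split: prod.splits)
  then show ?thesis
    by (simp add: V_def case_prod_unfold)
qed

text \<open>At most \<open>CARD('z) ^ k\<close> sequences have probability at least
  \<open>1 / CARD('z) ^ k\<close>, so they can be encoded injectively. By the weak law they carry
  almost all probability. Outside this set \<open>enc\<close> is arbitrary, hence the length of the
  code word is part of the success event.\<close>

lemma source_coding:
  fixes pS :: "'s::finite pmf"
  assumes H: "(\<Sum>s\<in>UNIV. - (pmf pS s * ln (pmf pS s))) < ln (real CARD('z::finite))" and \<epsilon>: "0 < \<epsilon>"
  shows "\<forall>\<^sub>F k in sequentially. \<exists>(enc :: 's list \<Rightarrow> 'z list) dec.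
    (\<Sum>s\<in>seqs k. prod_list (map (pmf pS) s) * of_bool (\<not> (length (enc s) = k \<and> dec (enc s) = s))) \<le> \<epsilon>"
proof -
  define L where "L = ln (real CARD('z))"
  define P where "P = (\<lambda>s. prod_list (map (pmf pS) s))"
  define f where "f = (\<lambda>s. - ln (pmf pS s))"
  have P0: "0 \<le> P s" for s
    unfolding P_def by (rule prod_list_map_nonneg) simp
  have P1: "(\<Sum>s\<in>seqs n. P s) = 1" for n
    by (simp add: P_def sum_seqs_prod_list sum_pmf_eq_1)
  have Pexp: "P s = exp (- sum_list (map f s))" if "P s \<noteq> 0" for s
    using that
  proof (induction s)
    case (Cons a s)
    then have "pmf pS a = exp (- f a)"
      by (simp add: P_def f_def pmf_pos)
    then show ?case
      using Cons by (simp add: P_def exp_diff exp_minus exp_add field_simps)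
  qed (simp add: P_def)
  have "(\<Sum>s\<in>UNIV. pmf pS s * f s) < L"
    using H by (simp add: f_def L_def)
  from chebyshev_seqs[OF _ _ this \<epsilon>]
  have "\<forall>\<^sub>F k in sequentially. (\<Sum>s\<in>seqs k. P s * of_bool (real k * L \<le> sum_list (map f s))) \<le> \<epsilon>"
    unfolding P_def by (simp add: sum_pmf_eq_1)
  then show ?thesis
  proof eventually_elim
    case (elim k)
    define A where "A = {s \<in> seqs k. exp (- (real k * L)) \<le> P s}"
    have "real (card A) * exp (- (real k * L)) \<le> (\<Sum>s\<in>A. P s)"
      using sum_mono[of A "\<lambda>_. exp (- (real k * L))" P] by (simp add: A_def)
    also have "\<dots> \<le> (\<Sum>s\<in>seqs k. P s)"
      by (rule sum_mono2) (auto simp: A_def P0)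
    finally have "real (card A) \<le> exp (real k * L)"
      by (simp add: P1 exp_minus field_simps)
    also have "\<dots> = real (card (seqs k :: 'z list set))"
      by (simp add: L_def exp_of_nat_mult card_seqs)
    finally have "card A \<le> card (seqs k :: 'z list set)"
      by simp
    then obtain enc :: "'s list \<Rightarrow> 'z list" where enc: "enc ` A \<subseteq> seqs k" "inj_on enc A"
      using card_le_inj[of A "seqs k :: 'z list set"] by (auto simp: A_def)
    have "(\<Sum>s\<in>seqs k. P s * of_bool (\<not> (length (enc s) = k \<and> inv_into A enc (enc s) = s))) \<le>
      (\<Sum>s\<in>seqs k. P s * of_bool (real k * L \<le> sum_list (map f s)))"
    proof (rule sum_mono)
      fix s :: "'s list"
      assume s: "s \<in> seqs k"
      show "P s * of_bool (\<not> (length (enc s) = k \<and> inv_into A enc (enc s) = s)) \<le>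
        P s * of_bool (real k * L \<le> sum_list (map f s))"
      proof (cases "P s = 0 \<or> real k * L \<le> sum_list (map f s)")
        case True
        then show ?thesis
          using P0[of s] by (auto simp: of_bool_def)
      next
        case False
        then have "s \<in> A"
          using s Pexp[of s] by (simp add: A_def)
        then show ?thesis
          using enc P0[of s] by (auto simp: seqs_def)
      qed
    qed
    with elim have "(\<Sum>s\<in>seqs k. P s * of_bool (\<not> (length (enc s) = k \<and> inv_into A enc (enc s) = s))) \<le> \<epsilon>"
      by linarith
    then show ?case
      unfolding P_def by blast
  qed
qed

section \<open>Achievability for non-causal codes\<close>

lemma marginal_window:
  fixes J :: "'a::finite \<Rightarrow> real"
  assumes J: "(\<Sum>x\<in>UNIV. J x) = 1" and ak: "a + k \<le> n"
  shows "(\<Sum>s\<in>seqs n. prod_list (map J s) * F (take k (drop a s))) = (\<Sum>u\<in>seqs k. prod_list (map J u) * F u)"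
proof -
  obtain d where n: "n = a + (k + d)"
    using ak by (metis add.assoc le_iff_add)
  have "(\<Sum>s\<in>seqs n. prod_list (map J s) * F (take k (drop a s))) =
    (\<Sum>v\<in>seqs a. \<Sum>u\<in>seqs k. \<Sum>w\<in>seqs d. prod_list (map J v) * (prod_list (map J u) * F u * prod_list (map J w)))"
    unfolding n sum_seqs_add by (intro sum.cong refl) (simp add: length_seqs)
  also have "\<dots> = (\<Sum>u\<in>seqs k. prod_list (map J u) * F u)"
    by (simp add: sum_distrib_left[symmetric] sum_distrib_right[symmetric] sum_seqs_prod_list J)
  finally show ?thesis .
qed

lemma sum_memoryless_drop:
  fixes W :: "'x \<Rightarrow> 's \<Rightarrow> 'y::finite pmf"
  assumes "length xs = k + n" "length ss = k + n"
  shows "(\<Sum>ys\<in>seqs (k + n). pmf (memoryless W xs ss) ys * F (drop k ys)) =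
    (\<Sum>ys\<in>seqs n. pmf (memoryless W (drop k xs) (drop k ss)) ys * F ys)"
proof -
  have "(\<Sum>ys\<in>seqs (k + n). pmf (memoryless W xs ss) ys * F (drop k ys)) =
    (\<Sum>us\<in>seqs k. \<Sum>vs\<in>seqs n. pmf (memoryless W (take k xs) (take k ss)) us *
      (pmf (memoryless W (drop k xs) (drop k ss)) vs * F vs))"
    unfolding sum_seqs_add
  proof (intro sum.cong refl)
    fix us vs :: "'y list"
    assume "us \<in> seqs k" "vs \<in> seqs n"
    then show "pmf (memoryless W xs ss) (us @ vs) * F (drop k (us @ vs)) =
      pmf (memoryless W (take k xs) (take k ss)) us *
      (pmf (memoryless W (drop k xs) (drop k ss)) vs * F vs)"
      using pmf_memoryless_append[of "take k xs" "take k ss" us W "drop k xs" "drop k ss" vs] assms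
      by (simp add: length_seqs)
  qed
  also have "\<dots> = (\<Sum>vs\<in>seqs n. pmf (memoryless W (drop k xs) (drop k ss)) vs * F vs)"
    using assms by (simp add: sum_distrib_left[symmetric] sum_distrib_right[symmetric] sum_memoryless)
  finally show ?thesis .
qed

text \<open>Identifies the product channel of \<open>strategy_coding\<close> with the actual channel
  whose input at state \<open>s\<close> is \<open>t s\<close>.\<close>

lemma prod_list_strategy:
  fixes W :: "'x \<Rightarrow> 's::finite \<Rightarrow> 'y::finite pmf"
  assumes "length ts = length ss" "length ss = length ys"
  shows "prod_list (map (\<lambda>(t, s, y). pmf pS s * pmf (W (t s) s) y) (zip ts (zip ss ys))) =
    prod_list (map (pmf pS) ss) * pmf (memoryless W (map2 (\<lambda>t s. t s) ts ss) ss) ys"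
  using assms
  by (induction ts ss ys rule: list_induct3) (simp_all add: pmf_memoryless_Cons del: memoryless.simps(1))

lemma length_inputs_nc: "length (inputs_nc n f g m s) = n"
  by (simp add: inputs_nc_def Let_def)

text \<open>
  Block Markov coding: while block \<open>j\<close> is transmitted, the state encoder sends the compressed states
  of block \<open>j + 1\<close>. The first block carries no information about the message.
\<close>

definition block_encoder :: "nat \<Rightarrow> ('s list \<Rightarrow> 'z list) \<Rightarrow> ('s, 'z) state_encoder" where
  "block_encoder k enc i s = enc (take k (drop (Suc ((i - 1) div k) * k) s)) ! ((i - 1) mod k)"

definition block_transmitter ::
  "nat \<Rightarrow> ('z list \<Rightarrow> 's list) \<Rightarrow> (nat \<Rightarrow> ('s \<Rightarrow> 'x) list) \<Rightarrow> ('z, 'x) transmitter" where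
  "block_transmitter k dec c i m x1 =
     (c m ! (i - 1 - k)) (dec (take k (drop (((i - 1) div k - 1) * k) x1)) ! ((i - 1) mod k))"

text \<open>In every block but the first, the transmitter has already seen the whole description of
  the current block, so it applies the strategies of the code word to the true states. The first
  block has junk inputs because subtraction truncates at zero, hence \<open>drop k\<close>. In the
  last block the encoder describes an empty window, which is never read.\<close>

lemma drop_inputs_nc_block:
  assumes k: "0 < k" and s: "length s = Suc b * k" and c: "length (c m) = b * k"
    and good: "\<And>j. j \<in> {1..b} \<Longrightarrow> length (enc (take k (drop (j * k) s))) = k \<and>
      dec (enc (take k (drop (j * k) s))) = take k (drop (j * k) s)"
  shows "drop k (inputs_nc (Suc b * k) (block_encoder k enc) (block_transmitter k dec c) m s) =
    map2 (\<lambda>t s. t s) (c m) (drop k s)"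
proof (rule nth_equalityI)
  let ?n = "Suc b * k"
  let ?x1 = "map (\<lambda>i. block_encoder k enc i s) [1..<Suc ?n]"
  show "length (drop k (inputs_nc ?n (block_encoder k enc) (block_transmitter k dec c) m s)) =
    length (map2 (\<lambda>t s. t s) (c m) (drop k s))"
    using s c by (simp add: length_inputs_nc)
  fix i
  assume "i < length (drop k (inputs_nc ?n (block_encoder k enc) (block_transmitter k dec c) m s))"
  then have i: "i < b * k"
    by (simp add: length_inputs_nc)
  define l where "l = k + i"
  have lk: "l - k = i"
    by (simp add: l_def)
  define j where "j = i div k"
  have l: "l < ?n" "l div k = Suc j" "l mod k = i mod k"
    using i k by (simp_all add: l_def j_def)
  have jb: "Suc j \<in> {1..b}"
    using i k by (simp add: j_def less_mult_imp_div_less Suc_le_eq)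
  have jk: "j * k + k \<le> l"
    unfolding l_def j_def by (simp add: div_times_less_eq_dividend)
  \<comment> \<open>\<open>take l\<close> is the strict past of time \<open>Suc l\<close>, and
    \<open>jk\<close> says that block \<open>j\<close> is complete by then.\<close>
  have window: "take k (drop (j * k) (take l ?x1)) = enc (take k (drop (Suc j * k) s))"
  proof (rule nth_equalityI)
    show "length (take k (drop (j * k) (take l ?x1))) = length (enc (take k (drop (Suc j * k) s)))"
      using jk l good[OF jb] by (simp del: upt_Suc)
    fix e
    assume "e < length (take k (drop (j * k) (take l ?x1)))"
    then have e: "e < k"
      by simp
    have "take k (drop (j * k) (take l ?x1)) ! e = ?x1 ! (j * k + e)"
      using e jk l by (simp del: upt_Suc)
    also have "\<dots> = block_encoder k enc (Suc (j * k + e)) s"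
      using e jk l by (subst nth_map) (auto simp del: upt_Suc)
    also have "\<dots> = enc (take k (drop (Suc j * k) s)) ! e"
      using e by (simp add: block_encoder_def)
    finally show "take k (drop (j * k) (take l ?x1)) ! e = enc (take k (drop (Suc j * k) s)) ! e" .
  qed
  have "drop k (inputs_nc ?n (block_encoder k enc) (block_transmitter k dec c) m s) ! i =
    block_transmitter k dec c (Suc l) m (take l ?x1)"
    using l(1) by (simp add: inputs_nc_def Let_def l_def del: upt_Suc mult_Suc)
  also have "\<dots> = (c m ! i) (dec (take k (drop (j * k) (take l ?x1))) ! (i mod k))"
    by (simp only: block_transmitter_def diff_Suc_1 l lk)
  also have "\<dots> = (c m ! i) (take k (drop (Suc j * k) s) ! (i mod k))"
    unfolding window using good[OF jb] by simp
  also have "take k (drop (Suc j * k) s) ! (i mod k) = s ! l"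
  proof -
    have "Suc j * k + i mod k = l"
      by (simp add: l_def j_def)
    moreover have "Suc j * k \<le> length s"
      using jk l(1) unfolding s mult_Suc by linarith
    ultimately show ?thesis
      using k by (simp only: nth_take nth_drop mod_less_divisor)
  qed
  also have "(c m ! i) (s ! l) = map2 (\<lambda>t s. t s) (c m) (drop k s) ! i"
    using i c s by (simp add: l_def)
  finally show "drop k (inputs_nc ?n (block_encoder k enc) (block_transmitter k dec c) m s) ! i =
    map2 (\<lambda>t s. t s) (c m) (drop k s) ! i" .
qed

text \<open>A union bound: either one of the \<open>b\<close> state descriptions fails, or the last
  \<open>b\<close> blocks see exactly the strategy channel. Each window has the i.i.d. law, so no
  independence of these events is required.\<close>

lemma block_code_error:
  fixes pS :: "'s::finite pmf" and W :: "'x::finite \<Rightarrow> 's \<Rightarrow> 'y::finite pmf"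
    and enc :: "'s list \<Rightarrow> 'z list" and c :: "nat \<Rightarrow> ('s \<Rightarrow> 'x) list" and D :: "nat \<Rightarrow> ('s \<times> 'y) list set"
  assumes k: "0 < k" and c: "c m \<in> seqs (b * k)" and D: "D m \<subseteq> seqs (b * k)"
    and err: "1 - \<epsilon> \<le> (\<Sum>bs\<in>D m. prod_list (map (\<lambda>(t, s, y). pmf pS s * pmf (W (t s) s) y) (zip (c m) bs)))"
    and src: "(\<Sum>s\<in>seqs k. prod_list (map (pmf pS) s) * of_bool (\<not> (length (enc s) = k \<and> dec (enc s) = s))) \<le> \<eta>"
  shows "(\<Sum>s\<in>seqs (Suc b * k). prod_list (map (pmf pS) s) *
      (\<Sum>y\<in>seqs (Suc b * k).
        pmf (memoryless W (inputs_nc (Suc b * k) (block_encoder k enc) (block_transmitter k dec c) m s) s) y *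
        of_bool (zip (drop k s) (drop k y) \<notin> D m))) \<le> real b * \<eta> + \<epsilon>"
proof -
  define n where "n = b * k"
  have n: "Suc b * k = k + n"
    by (simp add: n_def)
  define P where "P = (\<lambda>s. prod_list (map (pmf pS) s))"
  define \<phi> where "\<phi> = (\<lambda>s. inputs_nc (k + n) (block_encoder k enc) (block_transmitter k dec c) m s)"
  define bad where "bad = (\<lambda>s. \<not> (length (enc s) = k \<and> dec (enc s) = s))"
  define U where "U = (\<lambda>x s. \<Sum>y\<in>seqs n. pmf (memoryless W x s) y * of_bool (zip s y \<notin> D m))"
  define T where "T = (\<lambda>s. map2 (\<lambda>t s. t s) (c m) s)"
  have P0: "0 \<le> P s" for s
    unfolding P_def by (rule prod_list_map_nonneg) simp
  have U01: "0 \<le> U x s" "length x = n \<Longrightarrow> length s = n \<Longrightarrow> U x s \<le> 1" for x s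
  proof -
    show "0 \<le> U x s"
      unfolding U_def by (intro sum_nonneg) auto
    assume "length x = n" "length s = n"
    then have "(\<Sum>y\<in>seqs n. pmf (memoryless W x s) y) = 1"
      by (rule sum_memoryless)
    moreover have "U x s \<le> (\<Sum>y\<in>seqs n. pmf (memoryless W x s) y)"
      unfolding U_def by (intro sum_mono) auto
    ultimately show "U x s \<le> 1"
      by simp
  qed
  have cn: "length (c m) = n"
    using c by (simp add: seqs_def n_def)
  have point: "(\<Sum>y\<in>seqs (k + n). pmf (memoryless W (\<phi> s) s) y * of_bool (zip (drop k s) (drop k y) \<notin> D m))
    \<le> (\<Sum>j\<in>{1..b}. of_bool (bad (take k (drop (j * k) s)))) + U (T (drop k s)) (drop k s)"
    if s: "s \<in> seqs (k + n)" for s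
  proof -
    have ls: "length s = k + n" "length (\<phi> s) = k + n"
      using s by (simp_all add: seqs_def \<phi>_def length_inputs_nc)
    have eq: "(\<Sum>y\<in>seqs (k + n). pmf (memoryless W (\<phi> s) s) y * of_bool (zip (drop k s) (drop k y) \<notin> D m))
      = U (drop k (\<phi> s)) (drop k s)"
      unfolding U_def by (rule sum_memoryless_drop[OF ls(2,1)])
    \<comment> \<open>A failed description already contributes \<open>1\<close> to the bound, which
      covers every conditional error probability.\<close>
    show ?thesis
    proof (cases "\<exists>j\<in>{1..b}. bad (take k (drop (j * k) s))")
      case True
      then obtain j where "j \<in> {1..b}" "bad (take k (drop (j * k) s))"
        by blast
      then have "1 \<le> (\<Sum>j\<in>{1..b}. of_bool (bad (take k (drop (j * k) s))) :: real)"
        using member_le_sum[of j "{1..b}" "\<lambda>j. of_bool (bad (take k (drop (j * k) s))) :: real"] by simp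
      then show ?thesis
        unfolding eq using U01(2)[of "drop k (\<phi> s)" "drop k s"] U01(1)[of "T (drop k s)" "drop k s"] ls
        by simp
    next
      case False
      then have "drop k (\<phi> s) = T (drop k s)"
        unfolding \<phi>_def T_def n[symmetric]
        using k ls cn by (intro drop_inputs_nc_block) (auto simp: bad_def n_def)
      then show ?thesis
        unfolding eq by (simp add: sum_nonneg)
    qed
  qed
  have "(\<Sum>s\<in>seqs (k + n). P s *
      (\<Sum>y\<in>seqs (k + n). pmf (memoryless W (\<phi> s) s) y * of_bool (zip (drop k s) (drop k y) \<notin> D m)))
    \<le> (\<Sum>s\<in>seqs (k + n). P s * ((\<Sum>j\<in>{1..b}. of_bool (bad (take k (drop (j * k) s))))
      + U (T (drop k s)) (drop k s)))"
    using point by (intro sum_mono mult_left_mono P0)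
  also have "\<dots> = (\<Sum>j\<in>{1..b}. \<Sum>s\<in>seqs (k + n). P s * of_bool (bad (take k (drop (j * k) s)))) +
      (\<Sum>s\<in>seqs (k + n). P s * U (T (drop k s)) (drop k s))"
    by (simp only: distrib_left sum.distrib sum_distrib_left sum.swap[of _ "{1..b}"])
  also have "(\<Sum>j\<in>{1..b}. \<Sum>s\<in>seqs (k + n). P s * of_bool (bad (take k (drop (j * k) s)))) \<le> (\<Sum>j\<in>{1..b}. \<eta>)"
  proof (rule sum_mono)
    fix j
    assume "j \<in> {1..b}"
    then have "Suc j * k \<le> Suc b * k"
      by (intro mult_right_mono) auto
    then have "j * k + k \<le> k + n"
      by (simp add: n_def)
    then have "(\<Sum>s\<in>seqs (k + n). P s * of_bool (bad (take k (drop (j * k) s)))) = (\<Sum>u\<in>seqs k. P u * of_bool (bad u))"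
      unfolding P_def by (intro marginal_window[where F = "\<lambda>u. of_bool (bad u)"]) (simp_all add: sum_pmf_eq_1)
    then show "(\<Sum>s\<in>seqs (k + n). P s * of_bool (bad (take k (drop (j * k) s)))) \<le> \<eta>"
      using src by (simp add: P_def bad_def)
  qed
  also have "(\<Sum>s\<in>seqs (k + n). P s * U (T (drop k s)) (drop k s)) =
    (\<Sum>s\<in>seqs (k + n). P s * U (T (take n (drop k s))) (take n (drop k s)))"
    by (intro sum.cong refl) (simp add: length_seqs)
  also have "\<dots> = (\<Sum>s\<in>seqs n. P s * U (T s) s)"
    unfolding P_def by (intro marginal_window[where F = "\<lambda>s. U (T s) s"]) (simp_all add: sum_pmf_eq_1)
  also have "\<dots> \<le> \<epsilon>"
  proof -
    \<comment> \<open>With inputs \<open>T s\<close>, the sequence \<open>zip s y\<close> has the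
      product law \<open>V\<close>, to which the guarantee \<open>err\<close> for \<open>D m\<close>
      refers.\<close>
    define V where "V = (\<lambda>zs. prod_list (map (\<lambda>(t, s, y). pmf pS s * pmf (W (t s) s) y) (zip (c m) zs)))"
    have V: "V (zip s y) = P s * pmf (memoryless W (T s) s) y" if "s \<in> seqs n" "y \<in> seqs n" for s y
      unfolding V_def P_def T_def using that cn by (intro prod_list_strategy) (simp_all add: length_seqs)
    have sumV: "(\<Sum>zs\<in>seqs n. V zs * F zs) =
        (\<Sum>s\<in>seqs n. P s * (\<Sum>y\<in>seqs n. pmf (memoryless W (T s) s) y * F (zip s y)))" for F
      unfolding sum_seqs_zip[symmetric] sum_distrib_left
      by (intro sum.cong refl) (simp add: V mult.assoc)
    have "(\<Sum>s\<in>seqs n. P s * U (T s) s) = (\<Sum>zs\<in>seqs n. V zs * of_bool (zs \<notin> D m))"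
      unfolding U_def by (rule sumV[symmetric])
    also have "\<dots> = (\<Sum>zs\<in>seqs n. V zs) - (\<Sum>zs\<in>seqs n. V zs * of_bool (zs \<in> D m))"
      unfolding sum_subtractf[symmetric] by (intro sum.cong refl) (simp add: of_bool_def)
    also have "(\<Sum>zs\<in>seqs n. V zs * of_bool (zs \<in> D m)) = (\<Sum>zs\<in>D m. V zs)"
      using D by (intro sum.mono_neutral_cong_right) (auto simp: n_def)
    also have "(\<Sum>zs\<in>seqs n. V zs) = (\<Sum>s\<in>seqs n. P s * (\<Sum>y\<in>seqs n. pmf (memoryless W (T s) s) y))"
      using sumV[of "\<lambda>_. 1"] by simp
    also have "\<dots> = (\<Sum>s\<in>seqs n. P s * 1)"
      by (intro sum.cong refl arg_cong2[of _ _ _ _ "(*)"] sum_memoryless) (simp_all add: T_def cn length_seqs)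
    also have "\<dots> = 1"
      by (simp add: P_def sum_seqs_prod_list sum_pmf_eq_1)
    finally show ?thesis
      using err by (simp add: V_def)
  qed
  finally show ?thesis
    unfolding n by (simp add: P_def \<phi>_def)
qed

text \<open>Only \<open>b\<close> of the \<open>b + 1\<close> blocks carry the message. A large
  fixed \<open>b\<close> makes this rate loss smaller than the slack below the mutual information; a
  large block length \<open>k\<close> then makes the state descriptions and the channel code
  reliable.\<close>

theorem noncausal_achievability:
  fixes pS :: "'s::finite pmf" and W :: "'x::finite \<Rightarrow> 's \<Rightarrow> 'y::finite pmf" and p :: "'s \<Rightarrow> 'x pmf"
  assumes H: "(\<Sum>s\<in>UNIV. - (pmf pS s * ln (pmf pS s))) < ln (real CARD('z::finite))"
    and R0: "0 \<le> R"
    and R: "R * ln 2 < (\<Sum>s\<in>UNIV. pmf pS s * (\<Sum>x\<in>UNIV. pmf (p s) x *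
      (\<Sum>y\<in>UNIV. kl (pmf (W x s) y) (\<Sum>x'\<in>UNIV. pmf (p s) x' * pmf (W x' s) y))))"
  shows "achievable_nc TYPE('z) pS W R"
  unfolding achievable_nc_def
proof (intro conjI allI impI R0)
  fix \<epsilon> :: real and N :: nat
  assume \<epsilon>: "0 < \<epsilon>"
  obtain r where r: "R * ln 2 < r" "r < (\<Sum>s\<in>UNIV. pmf pS s * (\<Sum>x\<in>UNIV. pmf (p s) x *
      (\<Sum>y\<in>UNIV. kl (pmf (W x s) y) (\<Sum>x'\<in>UNIV. pmf (p s) x' * pmf (W x' s) y))))"
    using dense[OF R] by blast
  \<comment> \<open>Equivalent to \<open>(b + 1) * (R * ln 2) < b * r\<close>, the rate loss through
    the first block.\<close>
  obtain b where b: "R * ln 2 / (r - R * ln 2) < real b"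
    using reals_Archimedean2 by blast
  have "0 \<le> R * ln 2 / (r - R * ln 2)"
    using R0 r by simp
  with b have b0: "0 < b"
    by (cases b) auto
  define \<Delta> where "\<Delta> = real b * r - real (Suc b) * (R * ln 2)"
  have \<Delta>: "0 < \<Delta>"
    using b r by (simp add: \<Delta>_def field_simps)
  have "filterlim (\<lambda>k. b * k) sequentially sequentially"
    using b0 by (intro filterlim_subseq) (simp add: strict_mono_def)
  note ev1 = eventually_compose_filterlim[OF strategy_coding[OF r(2) half_gt_zero[OF \<epsilon>]] this]
  \<comment> \<open>Rounding up gives at most \<open>2 * 2 powr (n * R)\<close> messages;
    \<open>k * \<Delta>\<close> must pay for the factor \<open>2\<close>.\<close>
  have "\<forall>\<^sub>F k in sequentially. ln 2 / \<Delta> < real k"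
    using filterlim_real_sequentially by (simp add: filterlim_at_top_dense)
  moreover have "\<forall>\<^sub>F k in sequentially. \<exists>(enc :: 's list \<Rightarrow> 'z list) dec.
    (\<Sum>s\<in>seqs k. prod_list (map (pmf pS) s) * of_bool (\<not> (length (enc s) = k \<and> dec (enc s) = s))) \<le> \<epsilon> / (2 * real b)"
    using \<epsilon> b0 by (intro source_coding[OF H]) simp
  moreover note ev1
  moreover have "\<forall>\<^sub>F k in sequentially. max N 1 \<le> k"
    by (rule eventually_ge_at_top)
  ultimately have "\<forall>\<^sub>F k in sequentially. ln 2 / \<Delta> < real k \<and> max N 1 \<le> k \<and>
    (\<exists>(enc :: 's list \<Rightarrow> 'z list) dec.
      (\<Sum>s\<in>seqs k. prod_list (map (pmf pS) s) * of_bool (\<not> (length (enc s) = k \<and> dec (enc s) = s))) \<le> \<epsilon> / (2 * real b)) \<and>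
    (\<forall>M. real M \<le> exp (real (b * k) * r) \<longrightarrow>
      (\<exists>(c :: nat \<Rightarrow> ('s \<Rightarrow> 'x) list) D. (\<forall>j\<in>{1..M}. c j \<in> seqs (b * k) \<and> D j \<subseteq> seqs (b * k) \<and>
        1 - \<epsilon> / 2 \<le> (\<Sum>bs\<in>D j. prod_list (map (\<lambda>(t, s, y). pmf pS s * pmf (W (t s) s) y) (zip (c j) bs)))) \<and>
      disjoint_family_on D {1..M}))"
    by eventually_elim (intro conjI; assumption)
  then obtain k where k: "ln 2 / \<Delta> < real k" "max N 1 \<le> k"
    and src: "\<exists>(enc :: 's list \<Rightarrow> 'z list) dec.
      (\<Sum>s\<in>seqs k. prod_list (map (pmf pS) s) * of_bool (\<not> (length (enc s) = k \<and> dec (enc s) = s))) \<le> \<epsilon> / (2 * real b)"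
    and chan: "\<And>M. real M \<le> exp (real (b * k) * r) \<Longrightarrow>
      (\<exists>(c :: nat \<Rightarrow> ('s \<Rightarrow> 'x) list) D. (\<forall>j\<in>{1..M}. c j \<in> seqs (b * k) \<and> D j \<subseteq> seqs (b * k) \<and>
        1 - \<epsilon> / 2 \<le> (\<Sum>bs\<in>D j. prod_list (map (\<lambda>(t, s, y). pmf pS s * pmf (W (t s) s) y) (zip (c j) bs)))) \<and>
      disjoint_family_on D {1..M})"
    using eventually_happens'[OF sequentially_bot] by blast
  obtain enc :: "'s list \<Rightarrow> 'z list" and dec where
    enc: "(\<Sum>s\<in>seqs k. prod_list (map (pmf pS) s) * of_bool (\<not> (length (enc s) = k \<and> dec (enc s) = s))) \<le> \<epsilon> / (2 * real b)"
    using src by blast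
  define n where "n = Suc b * k"
  define M where "M = num_messages n R"
  have "real M \<le> exp (real (b * k) * r)"
  proof -
    have "1 \<le> 2 powr (real n * R)"
      using R0 by (simp add: ge_one_powr_ge_zero)
    then have "real M \<le> 2 * 2 powr (real n * R)"
      unfolding M_def num_messages_def by linarith
    also have "\<dots> = exp (ln 2 + real n * (R * ln 2))"
      by (simp add: exp_add powr_def mult_ac)
    also have "\<dots> \<le> exp (real (b * k) * r)"
    proof -
      have "ln 2 < real k * \<Delta>"
        using k(1) \<Delta> by (simp add: field_simps)
      then show ?thesis
        by (simp add: \<Delta>_def n_def algebra_simps)
    qed
    finally show ?thesis .
  qed
  from chan[OF this] obtain c :: "nat \<Rightarrow> ('s \<Rightarrow> 'x) list" and D where
    cD: "\<And>j. j \<in> {1..M} \<Longrightarrow> c j \<in> seqs (b * k)" "\<And>j. j \<in> {1..M} \<Longrightarrow> D j \<subseteq> seqs (b * k)"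
      "\<And>j. j \<in> {1..M} \<Longrightarrow>
        1 - \<epsilon> / 2 \<le> (\<Sum>bs\<in>D j. prod_list (map (\<lambda>(t, s, y). pmf pS s * pmf (W (t s) s) y) (zip (c j) bs)))"
    and dis: "disjoint_family_on D {1..M}"
    by blast
  \<comment> \<open>The default \<open>1\<close> keeps the decoder inside the message set when no
    decoding set is hit.\<close>
  define decoder where "decoder = (\<lambda>y s. if \<exists>m\<in>{1..M}. zip (drop k s) (drop k y) \<in> D m
    then SOME m. m \<in> {1..M} \<and> zip (drop k s) (drop k y) \<in> D m else 1)"
  have dec1: "decoder y s \<in> {1..M} \<and> zip (drop k s) (drop k y) \<in> D (decoder y s)"
    if "\<exists>m\<in>{1..M}. zip (drop k s) (drop k y) \<in> D m" for y s
    unfolding decoder_def if_P[OF that] by (rule someI_ex) (use that in blast)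
  have M0: "0 < M"
    by (simp add: M_def num_messages_pos)
  have valid: "valid_decoder n M decoder"
    unfolding valid_decoder_def
  proof (intro allI impI)
    fix y s
    show "decoder y s \<in> {1..M}"
    proof (cases "\<exists>m\<in>{1..M}. zip (drop k s) (drop k y) \<in> D m")
      case False
      then have "decoder y s = 1"
        by (simp only: decoder_def if_False)
      then show ?thesis
        using M0 by simp
    qed (use dec1 in blast)
  qed
  have dec2: "decoder y s = m" if "m \<in> {1..M}" "zip (drop k s) (drop k y) \<in> D m" for y s m
    using dec1[of s y] that dis unfolding disjoint_family_on_def by blast
  let ?\<phi> = "inputs_nc n (block_encoder k enc) (block_transmitter k dec c)"
  have "error_prob pS W n M ?\<phi> decoder =
    (\<Sum>m\<in>{1..M}. \<Sum>s\<in>seqs n. prod_list (map (pmf pS) s) *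
      (\<Sum>y\<in>seqs n. pmf (memoryless W (?\<phi> m s) s) y * of_bool (decoder y s \<noteq> m))) / real M"
    using M0 by (rule error_prob_eq) (simp add: length_inputs_nc)
  also have "\<dots> \<le> (\<Sum>m\<in>{1..M}. \<epsilon>) / real M"
  proof (intro divide_right_mono sum_mono)
    fix m
    assume m: "m \<in> {1..M}"
    have "(\<Sum>s\<in>seqs n. prod_list (map (pmf pS) s) *
        (\<Sum>y\<in>seqs n. pmf (memoryless W (?\<phi> m s) s) y * of_bool (decoder y s \<noteq> m))) \<le>
      (\<Sum>s\<in>seqs n. prod_list (map (pmf pS) s) *
        (\<Sum>y\<in>seqs n. pmf (memoryless W (?\<phi> m s) s) y * of_bool (zip (drop k s) (drop k y) \<notin> D m)))"
      using dec2[OF m] by (intro sum_mono mult_left_mono prod_list_map_nonneg) (auto simp: of_bool_def)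
    also have "\<dots> \<le> real b * (\<epsilon> / (2 * real b)) + \<epsilon> / 2"
      unfolding n_def using k m cD enc by (intro block_code_error) auto
    also have "\<dots> = \<epsilon>"
      using b0 by simp
    finally show "(\<Sum>s\<in>seqs n. prod_list (map (pmf pS) s) *
        (\<Sum>y\<in>seqs n. pmf (memoryless W (?\<phi> m s) s) y * of_bool (decoder y s \<noteq> m))) \<le> \<epsilon>" .
  qed simp
  also have "\<dots> = \<epsilon>"
    using M0 by simp
  finally have "error_prob pS W n M ?\<phi> decoder \<le> \<epsilon>" .
  moreover have "N \<le> n"
    using k(2) by (simp add: n_def)
  ultimately show "\<exists>n\<ge>N. \<exists>(f :: ('s, 'z) state_encoder) (g :: ('z, 'x) transmitter) dec.
      valid_decoder n (num_messages n R) dec \<and>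
      error_prob pS W n (num_messages n R) (inputs_nc n f g) dec \<le> \<epsilon>"
    using valid unfolding M_def by blast
qed

section \<open>The Z/S/noiseless example\<close>

lemma UNIV_num2: "(UNIV :: 2 set) = {0, 1}"
  using exhaust_2 by fastforce

lemma UNIV_num3: "(UNIV :: 3 set) = {0, 1, 2}"
  using exhaust_3 by fastforce

lemma num2_cases: "(x :: 2) = 0 \<or> x = 1"
  using UNIV_num2 by blast

lemma state_pmf_02: "pmf (state_pmf 0.2) 0 = 0.1" "pmf (state_pmf 0.2) 1 = 0.1" "pmf (state_pmf 0.2) 2 = 0.8"
  by (simp_all add: pmf_state_pmf)

lemma sum_state: "(\<Sum>s\<in>UNIV. pmf (state_pmf 0.2) s * F s) = (0.1 :: real) * F 0 + 0.1 * F 1 + 0.8 * F (2::3)"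
proof -
  have "(\<Sum>s\<in>UNIV. G s) = G 0 + G 1 + G (2::3)" for G :: "3 \<Rightarrow> real"
    unfolding UNIV_num3 using distinct_3 by (simp only: sum.insert finite.intros insert_iff empty_iff
        sum.empty simp_thms add_0_right add.assoc not_False_eq_True)
  then show ?thesis
    by (simp only: state_pmf_02)
qed

lemma sum_bit: "(\<Sum>x\<in>UNIV. F x) = F (0::2) + (F 1 :: real)"
  by (simp add: UNIV_num2)

text \<open>The entropy is about 0.92 bits. Multiplied by five, the claim becomes
  \<open>10 * (5 / 4) ^ 4 < 32\<close>.\<close>

lemma state_entropy: "(\<Sum>s\<in>UNIV. - (pmf (state_pmf 0.2) s * ln (pmf (state_pmf 0.2) s))) < ln (real CARD(2))"
proof -
  have "ln 10 + 4 * ln (5 / 4) = ln (10::real) + ln (625 / 256)"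
    using ln_realpow[of "5 / 4" 4] by (simp add: power_divide)
  also have "\<dots> = ln (10 * (625 / 256))"
    by (subst ln_mult) auto
  also have "\<dots> < ln 32"
    by (subst ln_less_cancel_iff) auto
  also have "\<dots> = 5 * ln 2"
    using ln_realpow[of 2 5] by simp
  finally have "ln 10 + 4 * ln (5 / 4) < 5 * ln (2::real)" .
  moreover have "ln (1 / 10) = - ln (10::real)" "ln (8 / 10) = - ln (5 / 4 :: real)"
    by (simp_all add: ln_div)
  moreover have "(\<Sum>s\<in>UNIV. - (pmf (state_pmf 0.2) s * ln (pmf (state_pmf 0.2) s))) =
    - 0.2 * ln (1 / 10) - 0.8 * ln (8 / 10 :: real)"
    unfolding sum_negf sum_state state_pmf_02 by simp
  ultimately show ?thesis
    by (simp only: card_num1 card_bit0 mult_1_right) (simp add: field_simps)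
qed

text \<open>\<open>z0\<close> and \<open>z1\<close> are the divergences of the inputs 0 and 1 of the
  Z-channel from the output law with probability \<open>t\<close> of 1; the weight 8 is the ratio of
  the state probabilities 0.8 and 0.1. At \<open>t = b\<close>, \<open>c = 1 / 2\<close> both
  inequalities are equalities. Along \<open>t = b + e\<close>,
  \<open>c = 1 / 2 - \<kappa> * e\<close> both left sides decrease to first order for a suitable
  \<open>\<kappa>\<close>, which exists because \<open>2 * b < 1 - \<alpha>\<close>.\<close>

lemma perturbation:
  fixes \<alpha> b :: real
  assumes \<alpha>: "0 < \<alpha>" "\<alpha> < 1" and b: "0 < b" "2 * b < 1 - \<alpha>"
  defines "z0 \<equiv> \<lambda>t. - ln (1 - t)"
    and "z1 \<equiv> \<lambda>t. \<alpha> * ln (\<alpha> / (1 - t)) + (1 - \<alpha>) * ln ((1 - \<alpha>) / t)"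
  assumes eq: "z1 b = z0 b"
  shows "\<exists>t c. 0 < t \<and> t < 1 \<and> 0 < c \<and> c < 1 \<and>
    z0 t - 8 * ln (1 - c) < z0 b + 8 * ln 2 \<and> z1 t - 8 * ln c < z0 b + 8 * ln 2"
proof -
  \<comment> \<open>Both derivatives are negative iff \<open>16 * \<kappa>\<close> lies between
    \<open>1 / (1 - b)\<close> and \<open>(1 - \<alpha>) / b - \<alpha> / (1 - b)\<close>. This
    interval has length \<open>d\<close>, and \<open>d\<close> is positive iff
    \<open>2 * b < 1 - \<alpha>\<close>.\<close>
  define d where "d = (1 - \<alpha>) / b - (1 + \<alpha>) / (1 - b)"
  have b1: "b < 1"
    using b \<alpha> by simp
  have d: "0 < d"
    using b b1 by (simp add: d_def field_simps)
  \<comment> \<open>The midpoint of that interval, so both derivatives equal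
    \<open>- d / 2\<close>.\<close>
  define \<kappa> where "\<kappa> = 1 / (1 - b) / 16 + d / 32"
  have \<kappa>: "0 < \<kappa>"
    unfolding \<kappa>_def using b1 d by (intro add_pos_pos divide_pos_pos) auto
  define F0 where "F0 = (\<lambda>e. z0 (b + e) - 8 * ln (1 / 2 + \<kappa> * e))"
  define F1 where "F1 = (\<lambda>e. z1 (b + e) - 8 * ln (1 / 2 - \<kappa> * e))"
  have half: "ln (1 / 2) = - ln (2::real)"
    by (simp add: ln_div)
  have F0': "(F0 has_real_derivative 1 / (1 - b) - 16 * \<kappa>) (at 0)"
    unfolding F0_def z0_def using b1 by (auto intro!: derivative_eq_intros simp: field_simps)
  have neg0: "1 / (1 - b) - 16 * \<kappa> < 0"
  proof -
    define u where "u = 1 / (1 - b)"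
    have "1 / (1 - b) = u" "\<kappa> = u / 16 + d / 32"
      by (simp_all add: u_def \<kappa>_def)
    then have "1 / (1 - b) - 16 * \<kappa> = - d / 2"
      by (simp add: field_simps)
    then show ?thesis
      using d by simp
  qed
  obtain e0 where e0: "0 < e0" "\<And>h. 0 < h \<Longrightarrow> h < e0 \<Longrightarrow> F0 h < F0 0"
    using DERIV_neg_dec_right[OF F0' neg0, unfolded add_0] by blast
  have F1': "(F1 has_real_derivative \<alpha> / (1 - b) - (1 - \<alpha>) / b + 16 * \<kappa>) (at 0)"
  proof -
    have D1: "((\<lambda>e. ln (\<alpha> / (1 - (b + e)))) has_real_derivative 1 / (1 - b)) (at 0)"
      using b1 \<alpha> by (auto intro!: derivative_eq_intros)
    have D2: "((\<lambda>e. ln ((1 - \<alpha>) / (b + e))) has_real_derivative - 1 / b) (at 0)"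
    proof -
      have "(\<alpha> - 1) / ((1 - \<alpha>) * b) = - 1 / b"
        using b \<alpha> by (simp add: divide_simps)
      then show ?thesis
        using b \<alpha> by (auto intro!: derivative_eq_intros)
    qed
    have D3: "((\<lambda>e. ln (1 / 2 - \<kappa> * e)) has_real_derivative - 2 * \<kappa>) (at 0)"
      by (auto intro!: derivative_eq_intros)
    show ?thesis
      using DERIV_diff[OF DERIV_add[OF DERIV_cmult[OF D1, of \<alpha>] DERIV_cmult[OF D2, of "1 - \<alpha>"]]
          DERIV_cmult[OF D3, of 8]]
      unfolding F1_def z1_def by (rule DERIV_cong) (simp add: algebra_simps diff_divide_distrib)
  qed
  have neg1: "\<alpha> / (1 - b) - (1 - \<alpha>) / b + 16 * \<kappa> < 0"
  proof -
    define u v w where "u = 1 / (1 - b)" and "v = (1 - \<alpha>) / b" and "w = \<alpha> / (1 - b)"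
    have "d = v - (u + w)" "\<kappa> = u / 16 + d / 32"
      by (simp_all add: d_def \<kappa>_def u_def v_def w_def add_divide_distrib)
    then have "w - v + 16 * \<kappa> = - d / 2"
      by (simp add: field_simps)
    then show ?thesis
      using d unfolding v_def w_def by simp
  qed
  obtain e1 where e1: "0 < e1" "\<And>h. 0 < h \<Longrightarrow> h < e1 \<Longrightarrow> F1 h < F1 0"
    using DERIV_neg_dec_right[OF F1' neg1, unfolded add_0] by blast
  \<comment> \<open>The last two bounds keep \<open>t\<close> below 1 and \<open>c\<close> above
    0.\<close>
  define m where "m = min (min e0 e1) (min (1 - b) (1 / (2 * \<kappa>)))"
  define e where "e = m / 2"
  have "0 < m"
    using e0(1) e1(1) b1 \<kappa> by (simp add: m_def)
  moreover have "m \<le> e0" "m \<le> e1" "m \<le> 1 - b" "m \<le> 1 / (2 * \<kappa>)"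
    by (simp_all add: m_def min_le_iff_disj)
  ultimately have e: "0 < e" "e < e0" "e < e1" "e < 1 - b" "e < 1 / (2 * \<kappa>)"
    by (simp_all add: e_def)
  have \<kappa>e: "0 < \<kappa> * e" "\<kappa> * e < 1 / 2"
    using e \<kappa> by (simp_all add: field_simps)
  show ?thesis
  proof (intro exI conjI)
    show "z0 (b + e) - 8 * ln (1 - (1 / 2 - \<kappa> * e)) < z0 b + 8 * ln 2"
      using e0(2)[OF e(1,2)] by (simp add: F0_def half)
    show "z1 (b + e) - 8 * ln (1 / 2 - \<kappa> * e) < z0 b + 8 * ln 2"
      using e1(2)[OF e(1,3)] by (simp add: F1_def half eq)
  qed (use e b \<kappa>e in auto)
qed

text \<open>\<open>b\<close> is the probability of output 1 under the capacity achieving output law,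
  where both inputs have equal divergence. Its input probability of 1 is
  \<open>b / (1 - \<alpha>)\<close>, and this is below \<open>1 / 2\<close> iff
  \<open>(1 + \<alpha>) * a < 1\<close> with \<open>a\<close> as in the proof. After taking
  logarithms, the bounds \<open>ln (1 + \<alpha>) < \<alpha>\<close> and
  \<open>ln \<alpha> < \<alpha> - 1\<close> cancel exactly.\<close>

lemma z_channel_optimum:
  fixes \<alpha> :: real
  assumes \<alpha>: "0 < \<alpha>" "\<alpha> < 1"
  shows "\<exists>b. 0 < b \<and> 2 * b < 1 - \<alpha> \<and>
    \<alpha> * ln (\<alpha> / (1 - b)) + (1 - \<alpha>) * ln ((1 - \<alpha>) / b) = - ln (1 - b)"
proof -
  \<comment> \<open>solving the equation for \<open>b\<close> gives \<open>b / (1 - b) = r\<close>\<close>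
  define a where "a = exp (\<alpha> / (1 - \<alpha>) * ln \<alpha>)"
  define r where "r = (1 - \<alpha>) * a"
  have a: "0 < a"
    by (simp add: a_def)
  have r: "0 < r"
    using \<alpha> a by (simp add: r_def)
  have "(1 - \<alpha>) * ln (1 + \<alpha>) + \<alpha> * ln \<alpha> < 0"
  proof -
    have "ln (1 + \<alpha>) < \<alpha>"
      using \<alpha> by (intro ln_add_one_self_less_self)
    moreover have "ln \<alpha> < \<alpha> - 1"
      using \<alpha> ln_less_self[of \<alpha>] ln_le_minus_one[of \<alpha>] ln_eq_minus_one[of \<alpha>] by fastforce
    ultimately have "(1 - \<alpha>) * ln (1 + \<alpha>) + \<alpha> * ln \<alpha> < (1 - \<alpha>) * \<alpha> + \<alpha> * (\<alpha> - 1)"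
      using \<alpha> by (intro add_strict_mono mult_strict_left_mono) auto
    then show ?thesis
      by (simp add: algebra_simps)
  qed
  then have "ln (1 + \<alpha>) + \<alpha> / (1 - \<alpha>) * ln \<alpha> < 0"
    using \<alpha> by (simp add: field_simps)
  then have "exp (ln (1 + \<alpha>) + \<alpha> / (1 - \<alpha>) * ln \<alpha>) < 1"
    by simp
  then have a1: "(1 + \<alpha>) * a < 1"
    using \<alpha> by (simp add: exp_add a_def)
  have "2 * a < 1 + r"
    using a1 by (simp add: r_def algebra_simps)
  then have "(1 - \<alpha>) * (2 * a) < (1 - \<alpha>) * (1 + r)"
    using \<alpha> by (intro mult_strict_left_mono) auto
  then have b2: "2 * (r / (1 + r)) < 1 - \<alpha>"
    using r by (simp add: r_def pos_divide_less_eq mult_ac)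
  have b1: "1 - r / (1 + r) = 1 / (1 + r)"
    using r by (simp add: field_simps)
  have lnr: "(1 - \<alpha>) * ln r = (1 - \<alpha>) * ln (1 - \<alpha>) + \<alpha> * ln \<alpha>"
  proof -
    have "ln r = ln (1 - \<alpha>) + \<alpha> / (1 - \<alpha>) * ln \<alpha>"
      unfolding r_def using \<alpha> a by (subst ln_mult) (auto simp: a_def)
    then show ?thesis
      using \<alpha> by (simp add: field_simps)
  qed
  have "ln (\<alpha> / (1 / (1 + r))) = ln \<alpha> + ln (1 + r)"
    using \<alpha> r by (simp add: ln_mult)
  moreover have "ln ((1 - \<alpha>) / (r / (1 + r))) = ln (1 - \<alpha>) + ln (1 + r) - ln r"
    using \<alpha> r by (simp add: ln_mult ln_div)
  moreover have "ln (1 / (1 + r)) = - ln (1 + r)"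
    using r by (simp add: ln_div)
  ultimately have "\<alpha> * ln (\<alpha> / (1 - r / (1 + r))) + (1 - \<alpha>) * ln ((1 - \<alpha>) / (r / (1 + r))) = - ln (1 - r / (1 + r))"
    using lnr by (simp only: b1) (simp add: algebra_simps)
  then show ?thesis
    using r b2 by (intro exI[of _ "r / (1 + r)"]) simp
qed

section \<open>Divergences in the three channel states\<close>

definition bit_law :: "real \<Rightarrow> 2 \<Rightarrow> real" where
  "bit_law t y = (if y = 1 then t else 1 - t)"

lemma pmf_zs_channel:
  assumes "0 < \<alpha>" "\<alpha> < 1"
  shows "pmf (zs_channel \<alpha> 0 0) 0 = 1" "pmf (zs_channel \<alpha> 0 0) 1 = 0"
    "pmf (zs_channel \<alpha> 1 0) 0 = \<alpha>" "pmf (zs_channel \<alpha> 1 0) 1 = 1 - \<alpha>"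
    "pmf (zs_channel \<alpha> 0 1) 0 = 1 - \<alpha>" "pmf (zs_channel \<alpha> 0 1) 1 = \<alpha>"
    "pmf (zs_channel \<alpha> 1 1) 0 = 0" "pmf (zs_channel \<alpha> 1 1) 1 = 1"
    "pmf (zs_channel \<alpha> 0 2) 0 = 1" "pmf (zs_channel \<alpha> 0 2) 1 = 0"
    "pmf (zs_channel \<alpha> 1 2) 0 = 0" "pmf (zs_channel \<alpha> 1 2) 1 = 1"
  using assms distinct_3 by (simp_all add: zs_channel_def pmf_bit_pmf)

text \<open>The S-channel is the Z-channel with 0 and 1 exchanged at input and output, hence the
  same formulas with \<open>1 - t\<close>.\<close>

lemma kl_zs_channel:
  assumes "0 < \<alpha>" "\<alpha> < 1" "0 < t" "t < 1"
  defines "K \<equiv> \<lambda>x s t. \<Sum>y\<in>UNIV. kl (pmf (zs_channel \<alpha> x s) y) (bit_law t y)"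
  shows "K 0 0 t = - ln (1 - t)"
    and "K 1 0 t = \<alpha> * ln (\<alpha> / (1 - t)) + (1 - \<alpha>) * ln ((1 - \<alpha>) / t)"
    and "K 0 1 (1 - t) = \<alpha> * ln (\<alpha> / (1 - t)) + (1 - \<alpha>) * ln ((1 - \<alpha>) / t)"
    and "K 1 1 (1 - t) = - ln (1 - t)"
    and "K 0 2 t = - ln (1 - t)"
    and "K 1 2 t = - ln t"
  unfolding K_def sum_bit using assms(1-4)
  by (simp_all add: pmf_zs_channel kl_def bit_law_def ln_div)

lemma sum_bit_law: "(\<Sum>y\<in>UNIV. bit_law t y) = 1"
  by (simp add: sum_bit bit_law_def)

lemma bit_law_pos: "0 < t \<Longrightarrow> t < 1 \<Longrightarrow> 0 < bit_law t y"
  by (simp add: bit_law_def)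

text \<open>
  A binary description \<open>h\<close> of the state merges two of the three states. Moving the output laws of
  these two states away from their capacity achieving ones lowers the divergence of every input.
\<close>

lemma merged_states_gap:
  fixes h :: "3 \<Rightarrow> 2"
  assumes \<alpha>: "0 < \<alpha>" "\<alpha> < 1" and b: "0 < b" "2 * b < 1 - \<alpha>"
    and eq: "\<alpha> * ln (\<alpha> / (1 - b)) + (1 - \<alpha>) * ln ((1 - \<alpha>) / b) = - ln (1 - b)"
  shows "\<exists>Q :: 3 \<Rightarrow> 2 \<Rightarrow> real. (\<forall>s y. 0 < Q s y) \<and> (\<forall>s. (\<Sum>y\<in>UNIV. Q s y) = 1) \<and>
    (\<forall>x. (\<Sum>s\<in>UNIV. pmf (state_pmf 0.2) s * (\<Sum>y\<in>UNIV. kl (pmf (zs_channel \<alpha> (x (h s)) s) y) (Q s y)))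
      < (4 * ln 2 - ln (1 - b)) / 5)"
proof -
  define K where "K = (\<lambda>x s t. \<Sum>y\<in>UNIV. kl (pmf (zs_channel \<alpha> x s) y) (bit_law t y))"
  have fold_K: "(\<Sum>y\<in>UNIV. kl (pmf (zs_channel \<alpha> x s) y) (bit_law t y)) = K x s t" for x s t
    by (simp add: K_def)
  define z0 where "z0 = (\<lambda>t::real. - ln (1 - t))"
  define z1 where "z1 = (\<lambda>t. \<alpha> * ln (\<alpha> / (1 - t)) + (1 - \<alpha>) * ln ((1 - \<alpha>) / t))"
  have K: "K 0 0 t = z0 t" "K 1 0 t = z1 t" "K 0 1 (1 - t) = z1 t" "K 1 1 (1 - t) = z0 t"
    "K 0 2 t = - ln (1 - t)" "K 1 2 t = - ln t" if "0 < t" "t < 1" for t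
    unfolding K_def z0_def z1_def using kl_zs_channel[OF \<alpha> that] by simp_all
  have b1: "b < 1"
    using b \<alpha> by simp
  have zb: "z1 b = z0 b"
    using eq by (simp add: z0_def z1_def)
  obtain t c where t: "0 < t" "t < 1" and c: "0 < c" "c < 1"
    and P: "z0 t - 8 * ln (1 - c) < z0 b + 8 * ln 2" "z1 t - 8 * ln c < z0 b + 8 * ln 2"
    using perturbation[OF \<alpha> b eq] unfolding z0_def z1_def by blast
  have c': "0 < 1 - c" "1 - c < 1"
    using c by auto
  have half: "ln (1 / 2) = - ln (2::real)"
    by (simp add: ln_div)
  \<comment> \<open>Adding the two inequalities \<open>P\<close> and using
    \<open>(1 - c) * c \<le> 1 / 4\<close> shows that the same \<open>t\<close> also serves when the
    states 0 and 1 are merged.\<close>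
  have sum: "z0 t + z1 t < 2 * z0 b"
  proof -
    have "(1 - c) * c \<le> (1 / 2) * (1 / 2)"
      using zero_le_power2[of "c - 1 / 2"] by (simp add: power2_eq_square algebra_simps)
    then have "ln ((1 - c) * c) \<le> ln ((1 / 2) * (1 / 2))"
      using c by (intro ln_mono) auto
    moreover have "ln ((1 - c) * c) = ln (1 - c) + ln c"
      using c by (simp add: ln_mult)
    moreover have "ln ((1 / 2) * (1 / 2)) = - 2 * ln (2::real)"
      by (subst ln_mult) (simp_all add: half)
    ultimately show ?thesis
      using P by linarith
  qed
  \<comment> \<open>Everything is multiplied by ten, so the three states have weights 1, 1 and
    8.\<close>
  have "\<exists>t0 t1 c. 0 < t0 \<and> t0 < 1 \<and> 0 < t1 \<and> t1 < 1 \<and> 0 < c \<and> c < 1 \<and>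
    (\<forall>x. K (x (h 0)) 0 t0 + K (x (h 1)) 1 t1 + 8 * K (x (h 2)) 2 c < 2 * z0 b + 8 * ln 2)"
  proof -
    consider "h 1 = h 0" | "h 2 = h 0" | "h 2 = h 1"
      using num2_cases by metis
    then show ?thesis
    proof cases
      case 1
      have "K v 0 t + K v 1 (1 - t) + 8 * K w 2 (1 / 2) < 2 * z0 b + 8 * ln 2" for v w
        using num2_cases[of v] num2_cases[of w] sum K(1-4)[OF t] K(5,6)[of "1 / 2"] half by auto
      with 1 show ?thesis
        using t by (intro exI[of _ t] exI[of _ "1 - t"] exI[of _ "1 / 2"]) auto
    next
      \<comment> \<open>States 0 and 2 share the input \<open>v\<close> and receive the perturbed
        laws. State 1 keeps its optimal law, for which both inputs give \<open>z0 b\<close>.\<close>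
      case 2
      have "K v 0 t + K w 1 (1 - b) + 8 * K v 2 c < 2 * z0 b + 8 * ln 2" for v w
        using num2_cases[of v] num2_cases[of w] P K(1,2)[OF t] K(3,4)[OF b(1) b1] K(5,6)[OF c] zb by auto
      with 2 show ?thesis
        using t b b1 c by (intro exI[of _ t] exI[of _ "1 - b"] exI[of _ c]) auto
    next
      \<comment> \<open>The mirror image of the previous case, with 0 and 1 exchanged.\<close>
      case 3
      have "K w 0 b + K v 1 (1 - t) + 8 * K v 2 (1 - c) < 2 * z0 b + 8 * ln 2" for v w
        using num2_cases[of v] num2_cases[of w] P K(3,4)[OF t] K(1,2)[OF b(1) b1] K(5,6)[OF c'] zb by auto
      with 3 show ?thesis
        using t b b1 c by (intro exI[of _ b] exI[of _ "1 - t"] exI[of _ "1 - c"]) auto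
    qed
  qed
  then obtain t0 t1 c where tc: "0 < t0" "t0 < 1" "0 < t1" "t1 < 1" "0 < c" "c < 1"
    and less: "\<And>x. K (x (h 0)) 0 t0 + K (x (h 1)) 1 t1 + 8 * K (x (h 2)) 2 c < 2 * z0 b + 8 * ln 2"
    by blast
  define Q where "Q = (\<lambda>s::3. bit_law (if s = 0 then t0 else if s = 1 then t1 else c))"
  have Q: "Q 0 = bit_law t0" "Q 1 = bit_law t1" "Q 2 = bit_law c"
    using distinct_3 by (simp_all add: Q_def)
  show ?thesis
  proof (intro exI[of _ Q] conjI allI)
    show "0 < Q s y" for s y
      unfolding Q_def using tc by (simp add: bit_law_pos)
    show "(\<Sum>y\<in>UNIV. Q s y) = 1" for s
      unfolding Q_def by (rule sum_bit_law)
    fix x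
    have "(\<Sum>s\<in>UNIV. pmf (state_pmf 0.2) s * (\<Sum>y\<in>UNIV. kl (pmf (zs_channel \<alpha> (x (h s)) s) y) (Q s y))) =
      (K (x (h 0)) 0 t0 + K (x (h 1)) 1 t1 + 8 * K (x (h 2)) 2 c) / 10"
      unfolding sum_state Q fold_K by simp
    also have "\<dots> < (4 * ln 2 - ln (1 - b)) / 5"
      using less[of x] by (simp add: z0_def)
    finally show "(\<Sum>s\<in>UNIV. pmf (state_pmf 0.2) s * (\<Sum>y\<in>UNIV. kl (pmf (zs_channel \<alpha> (x (h s)) s) y) (Q s y)))
      < (4 * ln 2 - ln (1 - b)) / 5" .
  qed
qed

text \<open>The input probability \<open>b / (1 - \<alpha>)\<close> produces the optimal output law
  in state 0, its mirror image does so in state 1, and uniform input does so in state 2. All inputs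
  of a state then have the same divergence, so averaging over them returns that value.\<close>

lemma zs_information:
  assumes \<alpha>: "0 < \<alpha>" "\<alpha> < 1" and b: "0 < b" "2 * b < 1 - \<alpha>"
    and eq: "\<alpha> * ln (\<alpha> / (1 - b)) + (1 - \<alpha>) * ln ((1 - \<alpha>) / b) = - ln (1 - b)"
  shows "\<exists>p :: 3 \<Rightarrow> 2 pmf. (\<Sum>s\<in>UNIV. pmf (state_pmf 0.2) s * (\<Sum>x\<in>UNIV. pmf (p s) x *
      (\<Sum>y\<in>UNIV. kl (pmf (zs_channel \<alpha> x s) y) (\<Sum>x'\<in>UNIV. pmf (p s) x' * pmf (zs_channel \<alpha> x' s) y))))
    = (4 * ln 2 - ln (1 - b)) / 5"
proof -
  define \<pi> where "\<pi> = b / (1 - \<alpha>)"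
  have \<pi>: "0 \<le> \<pi>" "\<pi> \<le> 1" "\<pi> * (1 - \<alpha>) = b"
    using b \<alpha> by (simp_all add: \<pi>_def)
  have b1: "b < 1"
    using b \<alpha> by simp
  define p where "p = (\<lambda>s::3. bit_pmf (if s = 0 then \<pi> else if s = 1 then 1 - \<pi> else 1 / 2))"
  define q where "q = (\<lambda>s y. \<Sum>x'\<in>UNIV. pmf (p s) x' * pmf (zs_channel \<alpha> x' s) y)"
  have p: "pmf (p 0) 0 = 1 - \<pi>" "pmf (p 0) 1 = \<pi>" "pmf (p 1) 0 = \<pi>" "pmf (p 1) 1 = 1 - \<pi>"
    "pmf (p 2) 0 = 1 / 2" "pmf (p 2) 1 = 1 / 2"
    using \<pi> distinct_3 by (simp_all add: p_def pmf_bit_pmf)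
  have q_eq: "q s = bit_law t" if "q s 0 = 1 - t" "q s 1 = t" for s t
  proof
    fix y
    show "q s y = bit_law t y"
      using num2_cases[of y] that by (auto simp: bit_law_def)
  qed
  have q: "q 0 = bit_law b" "q 1 = bit_law (1 - b)" "q 2 = bit_law (1 / 2)"
    by (rule q_eq; use \<pi>(3) in \<open>simp add: q_def sum_bit p pmf_zs_channel[OF \<alpha>] algebra_simps\<close>)+
  have half: "ln (1 / 2) = - ln (2::real)"
    by (simp add: ln_div)
  define K where "K = (\<lambda>x s t. \<Sum>y\<in>UNIV. kl (pmf (zs_channel \<alpha> x s) y) (bit_law t y))"
  have fold_K: "(\<Sum>y\<in>UNIV. kl (pmf (zs_channel \<alpha> x s) y) (bit_law t y)) = K x s t" for x s t
    by (simp add: K_def)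
  have K: "K 0 0 b = - ln (1 - b)" "K 1 0 b = - ln (1 - b)" "K 0 1 (1 - b) = - ln (1 - b)"
    "K 1 1 (1 - b) = - ln (1 - b)" "K 0 2 (1 / 2) = ln 2" "K 1 2 (1 / 2) = ln 2"
    unfolding K_def using kl_zs_channel[OF \<alpha> b(1) b1] kl_zs_channel[OF \<alpha>, of "1 / 2"] eq half by simp_all
  have "(\<Sum>s\<in>UNIV. pmf (state_pmf 0.2) s * (\<Sum>x\<in>UNIV. pmf (p s) x *
      (\<Sum>y\<in>UNIV. kl (pmf (zs_channel \<alpha> x s) y) (q s y)))) = (4 * ln 2 - ln (1 - b)) / 5"
    unfolding sum_state q fold_K
    unfolding sum_bit p K by (simp add: field_simps)
  then show ?thesis
    unfolding q_def by blast
qed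

theorem mainTheorem5:
  fixes \<alpha> :: real
  assumes "0 < \<alpha>" and "\<alpha> < 1"
  shows "capacity_nc TYPE(2) (state_pmf 0.2) (zs_channel \<alpha>)
       > capacity_c TYPE(2) (state_pmf 0.2) (zs_channel \<alpha>)"
proof -
  obtain b where b: "0 < b" "2 * b < 1 - \<alpha>"
    and eq: "\<alpha> * ln (\<alpha> / (1 - b)) + (1 - \<alpha>) * ln ((1 - \<alpha>) / b) = - ln (1 - b)"
    using z_channel_optimum[OF assms] by blast
  \<comment> \<open>The rate \<open>0.8 ln 2 + 0.2 C_Z\<close> in nats, with
    \<open>C_Z = - ln (1 - b)\<close>.\<close>
  define I where "I = (4 * ln 2 - ln (1 - b)) / 5"
  have "ln (1 - b) < 0"
    using b assms by simp
  moreover have "0 < ln (2::real)"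
    by simp
  ultimately have I: "0 < I"
    unfolding I_def by (intro divide_pos_pos) linarith+
  obtain p :: "3 \<Rightarrow> 2 pmf" where p: "(\<Sum>s\<in>UNIV. pmf (state_pmf 0.2) s * (\<Sum>x\<in>UNIV. pmf (p s) x *
      (\<Sum>y\<in>UNIV. kl (pmf (zs_channel \<alpha> x s) y) (\<Sum>x'\<in>UNIV. pmf (p s) x' * pmf (zs_channel \<alpha> x' s) y)))) = I"
    using zs_information[OF assms b eq] unfolding I_def by blast
  define S where "S = (\<lambda>Q (h :: 3 \<Rightarrow> 2) x. \<Sum>s\<in>UNIV. pmf (state_pmf 0.2) s *
    (\<Sum>y\<in>UNIV. kl (pmf (zs_channel \<alpha> (x (h s)) s) y) (Q s y)))"
  have "\<forall>h. \<exists>Q. (\<forall>s y. 0 < Q s y) \<and> (\<forall>s. (\<Sum>y\<in>UNIV. Q s y) = 1) \<and> (\<forall>x. S Q h x < I)"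
    using merged_states_gap[OF assms b eq] unfolding S_def I_def by simp
  then obtain Q where Q: "\<And>h s y. 0 < Q h s y" "\<And>h s. (\<Sum>y\<in>UNIV. Q h s y) = 1"
    and less: "\<And>h x. S (Q h) h x < I"
    by metis
  \<comment> \<open>The maximum over the finitely many pairs of maps turns the strict inequalities
    into a uniform gap below \<open>I\<close>.\<close>
  define C where "C = Max (range (\<lambda>(h, x). S (Q h) h x))"
  have "C \<in> range (\<lambda>(h, x). S (Q h) h x)"
    unfolding C_def by (rule Max_in) auto
  then have CI: "C < I"
    using less by auto
  have C: "S (Q h) h x \<le> C" for h x
    unfolding C_def by (rule Max_ge) (auto intro: range_eqI[of _ _ "(h, x)"])
  \<comment> \<open>A rate in nats strictly between the bounds; the maximum with 0 is there because
    achievable rates are nonnegative.\<close>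
  obtain R where R: "max C 0 < R" "R < I"
    using dense[of "max C 0" I] CI I by auto
  have "capacity_c TYPE(2) (state_pmf 0.2) (zs_channel \<alpha>) \<le> ereal (C / ln 2)"
    unfolding capacity_c_def
  proof (rule SUP_least)
    fix R'
    assume "R' \<in> {R. achievable_c TYPE(2) (state_pmf 0.2) (zs_channel \<alpha>) R}"
    then have "R' * ln 2 \<le> C"
      using C unfolding S_def by (intro causal_converse[OF Q]) auto
    then show "ereal R' \<le> ereal (C / ln 2)"
      by (simp add: field_simps)
  qed
  also have "\<dots> < ereal (R / ln 2)"
    using R by (simp add: divide_strict_right_mono)
  also have "\<dots> \<le> capacity_nc TYPE(2) (state_pmf 0.2) (zs_channel \<alpha>)"
    unfolding capacity_nc_def
  proof (rule SUP_upper)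
    have "achievable_nc TYPE(2) (state_pmf 0.2) (zs_channel \<alpha>) (R / ln 2)"
      by (rule noncausal_achievability[OF state_entropy, where p = p]) (use R p in auto)
    then show "R / ln 2 \<in> {R. achievable_nc TYPE(2) (state_pmf 0.2) (zs_channel \<alpha>) R}"
      by simp
  qed
  finally show ?thesis .
qed

end
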